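(* Assume $N\ge n\ge 1$. Let $f:\mathbb{B}^n\to\mathbb{B}^N$ be a rational holomorphic proper map with Hermitian invariant group $\Gamma_f$. Then $\Gamma_f$ contains an $n$-torus, that is, a conjugate (by an element of $\mathrm{Aut}(\mathbb{B}^n)$) of $\mathbf{U}(1)\oplus\cdots\oplus\mathbf{U}(1)$ ($n$ summands), if and only if $f$ is spherically equivalent to a monomial map.
   Context: $\mathbb{B}^n$ is the open unit ball of $\mathbb{C}^n$ and $\mathrm{Aut}(\mathbb{B}^n)$ is its group of holomorphic automorphisms. The group $\mathbf{U}(1)\oplus\cdots\oplus\mathbf{U}(1)$ ($n$ summands) is the group of diagonal unitary matrices acting on $\mathbb{C}^n$. The Hermitian invariant group of a rational proper map $f:\mathbb{B}^n\to\mathbb{B}^N$ is $$\Gamma_f=\{\gamma\in\mathrm{Aut}(\mathbb{B}^n):\ \text{there is } \psi\in\mathrm{Aut}(\mathbb{B}^N)\text{ with } f\circ\gamma=\psi\circ f\}.$$ Proper maps $f,g:\mathbb{B}^n\to\mathbb{B}^N$ are spherically equivalent if there are $\phi\in\mathrm{Aut}(\mathbb{B}^n)$ and $\chi\in\mathrm{Aut}(\mathbb{B}^N)$ with $f=\chi\circ g\circ\phi$. A monomial map is a map each of whose components is a constant (possibly zero) times a monomial $z^\alpha$. *)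

theory Defs
  imports "HOL-Analysis.Analysis" "HOL-Algebra.Bij"
begin

text \<open>The norm on \<^typ>\<open>complex ^ 'n\<close> is the Hermitian norm.\<close>

abbreviation unit_ball :: "(complex ^ 'n) set" where
  "unit_ball \<equiv> ball 0 1"

text \<open>Meant for open \<open>S\<close>: the real derivative exists at every point and is complex linear.\<close>

definition holomorphic_map_on :: "(complex ^ 'n \<Rightarrow> complex ^ 'm) \<Rightarrow> (complex ^ 'n) set \<Rightarrow> bool"
  where "holomorphic_map_on f S \<longleftrightarrow>
    (\<forall>z\<in>S. \<exists>D. (f has_derivative D) (at z within S) \<and> (\<forall>c v. D (c *s v) = c *s D v))"

text \<open>Throughout, a map defined on the ball is a total function whose values outside the ball
  are ignored; only automorphisms are normalised (to extensional functions), so that they form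
  a group.\<close>

definition proper_holomorphic_ball_map :: "(complex ^ 'n \<Rightarrow> complex ^ 'm) \<Rightarrow> bool"
  where "proper_holomorphic_ball_map f \<longleftrightarrow>
    holomorphic_map_on f unit_ball \<and>
    proper_map (top_of_set unit_ball) (top_of_set unit_ball) f"

definition monom_fun :: "('n \<Rightarrow> nat) \<Rightarrow> complex ^ 'n \<Rightarrow> complex"
  where "monom_fun \<alpha> z = (\<Prod>i\<in>UNIV. (z $ i) ^ \<alpha> i)"

definition polynomial_fun :: "(complex ^ 'n \<Rightarrow> complex) \<Rightarrow> bool"
  where "polynomial_fun p \<longleftrightarrow>
    (\<exists>A c. finite A \<and> (\<forall>z. p z = (\<Sum>\<alpha>\<in>A. c \<alpha> * monom_fun \<alpha> z)))"

text \<open>The fraction is not required to be in lowest terms, so the denominator may vanish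
  somewhere in the ball; it is only required not to be the zero polynomial.\<close>

definition rational_ball_map :: "(complex ^ 'n \<Rightarrow> complex ^ 'm) \<Rightarrow> bool"
  where "rational_ball_map f \<longleftrightarrow>
    (\<exists>p q. (\<forall>j. polynomial_fun (p j)) \<and> polynomial_fun q \<and> (\<exists>z. q z \<noteq> 0) \<and>
       (\<forall>z\<in>unit_ball. q z \<noteq> 0 \<longrightarrow> (\<forall>j. f z $ j = p j z / q z)))"

definition monomial_ball_map :: "(complex ^ 'n \<Rightarrow> complex ^ 'm) \<Rightarrow> bool"
  where "monomial_ball_map f \<longleftrightarrow>
    (\<forall>j. \<exists>c \<alpha>. \<forall>z\<in>unit_ball. f z $ j = c * monom_fun \<alpha> z)"

text \<open>Multiplication is composition, restricted to the ball.\<close>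

definition ball_Aut :: "(complex ^ 'n \<Rightarrow> complex ^ 'n) monoid"
  where "ball_Aut = (BijGroup unit_ball)
    \<lparr>carrier := {\<gamma> \<in> Bij unit_ball. holomorphic_map_on \<gamma> unit_ball \<and>
                  holomorphic_map_on (inv_into unit_ball \<gamma>) unit_ball}\<rparr>"

definition diagonal_torus :: "(complex ^ 'n \<Rightarrow> complex ^ 'n) set"
  where "diagonal_torus =
    {(\<lambda>z\<in>unit_ball. \<chi> i. u i * z $ i) | u. \<forall>i. norm (u i) = 1}"

definition Hermitian_invariant_group ::
    "(complex ^ 'n \<Rightarrow> complex ^ 'm) \<Rightarrow> (complex ^ 'n \<Rightarrow> complex ^ 'n) set"
  where "Hermitian_invariant_group f =
    {\<gamma> \<in> carrier ball_Aut. \<exists>\<psi>\<in>carrier ball_Aut. \<forall>z\<in>unit_ball. f (\<gamma> z) = \<psi> (f z)}"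

definition contains_full_torus :: "(complex ^ 'n \<Rightarrow> complex ^ 'n) set \<Rightarrow> bool"
  where "contains_full_torus \<Gamma> \<longleftrightarrow>
    (\<exists>\<phi>\<in>carrier ball_Aut.
       (\<lambda>t. \<phi> \<otimes>\<^bsub>ball_Aut\<^esub> t \<otimes>\<^bsub>ball_Aut\<^esub> inv\<^bsub>ball_Aut\<^esub> \<phi>) ` diagonal_torus \<subseteq> \<Gamma>)"

definition spherically_equivalent ::
    "(complex ^ 'n \<Rightarrow> complex ^ 'm) \<Rightarrow> (complex ^ 'n \<Rightarrow> complex ^ 'm) \<Rightarrow> bool"
  where "spherically_equivalent f g \<longleftrightarrow>
    (\<exists>\<phi>\<in>carrier ball_Aut. \<exists>\<psi>\<in>carrier ball_Aut. \<forall>z\<in>unit_ball. f z = \<psi> (g (\<phi> z)))"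


lemma proper_holomorphic_ball_map_iff_compact_preimage:
  fixes f :: "complex ^ 'n \<Rightarrow> complex ^ 'm"
  shows "proper_holomorphic_ball_map f \<longleftrightarrow>
    holomorphic_map_on f unit_ball \<and> f ` unit_ball \<subseteq> unit_ball \<and>
    (\<forall>K \<subseteq> unit_ball. compact K \<longrightarrow> compact {z \<in> unit_ball. f z \<in> K})"
proof -
  let ?X = "top_of_set (unit_ball :: (complex ^ 'n) set)"
  let ?Y = "top_of_set (unit_ball :: (complex ^ 'm) set)"
  have k: "k_space ?Y"
    using metrizable_imp_k_space metrizable_space_euclidean metrizable_space_subtopology by blast
  have h: "kc_space ?Y" "kc_space ?X"
    by (simp_all add: Hausdorff_imp_kc_space Hausdorff_space_subtopology)
  have cX: "compactin ?X K \<longleftrightarrow> compact K \<and> K \<subseteq> unit_ball" for K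
    by (auto simp: compactin_subtopology)
  have cY: "compactin ?Y K \<longleftrightarrow> compact K \<and> K \<subseteq> unit_ball" for K
    by (auto simp: compactin_subtopology)
  have "proper_map ?X ?Y f \<longleftrightarrow> f \<in> unit_ball \<rightarrow> unit_ball \<and>
      (\<forall>K. compactin ?Y K \<longrightarrow> compactin ?X {z \<in> unit_ball. f z \<in> K})" (is "?l \<longleftrightarrow> ?r")
  proof
    assume l: ?l
    show ?r
      using proper_map_imp_subset_topspace[OF l] compactin_proper_map_preimage[OF l]
      by (simp del: mem_ball mem_ball_0)
  next
    assume ?r
    then show ?l
      using h by (intro compact_imp_proper_map[OF k]) (simp_all del: mem_ball mem_ball_0)
  qed
  then show ?thesis
    unfolding proper_holomorphic_ball_map_def cX cY by (auto simp del: mem_ball mem_ball_0)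
qed

lemma holomorphic_map_on_compose:
  assumes "holomorphic_map_on f S" "holomorphic_map_on g T" "f ` S \<subseteq> T"
  shows "holomorphic_map_on (\<lambda>z. g (f z)) S"
  unfolding holomorphic_map_on_def
proof
  fix z assume z: "z \<in> S"
  obtain D where D: "(f has_derivative D) (at z within S)" "\<And>c v. D (c *s v) = c *s D v"
    using assms(1) z unfolding holomorphic_map_on_def by blast
  obtain E where E: "(g has_derivative E) (at (f z) within T)" "\<And>c v. E (c *s v) = c *s E v"
    using assms(2,3) z unfolding holomorphic_map_on_def by blast
  have "((\<lambda>z. g (f z)) has_derivative (\<lambda>v. E (D v))) (at z within S)"
    using has_derivative_in_compose[OF D(1) has_derivative_subset[OF E(1) assms(3)]] .
  then show "\<exists>D. ((\<lambda>z. g (f z)) has_derivative D) (at z within S) \<and>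
      (\<forall>c v. D (c *s v) = c *s D v)"
    using D(2) E(2) by auto
qed

lemma holomorphic_map_on_cong:
  assumes "holomorphic_map_on f S" "\<And>z. z \<in> S \<Longrightarrow> f z = g z"
  shows "holomorphic_map_on g S"
  using assms unfolding holomorphic_map_on_def
  by (metis (no_types, lifting) has_derivative_transform)

lemma holomorphic_map_on_diagonal:
  fixes u :: "'n::finite \<Rightarrow> complex"
  shows "holomorphic_map_on (\<lambda>z. \<chi> i. u i * z $ i) S"
proof -
  have "bounded_linear (\<lambda>z :: complex ^ 'n. \<chi> i. u i * z $ i)"
    by (intro linear_conv_bounded_linear[THEN iffD1] linearI)
       (auto simp: vec_eq_iff algebra_simps)
  then show ?thesis
    unfolding holomorphic_map_on_def
    by (intro ballI exI[of _ "\<lambda>z. \<chi> i. u i * z $ i"])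
       (auto simp: vec_eq_iff intro: bounded_linear_imp_has_derivative)
qed

lemma subgroup_ball_Aut_BijGroup:
  "subgroup (carrier (ball_Aut :: (complex ^ 'n \<Rightarrow> complex ^ 'n) monoid)) (BijGroup unit_ball)"
  (is "subgroup ?H ?G")
proof -
  interpret group ?G by (rule group_BijGroup)
  let ?B = "unit_ball :: (complex ^ 'n) set"
  have inveq: "inv\<^bsub>?G\<^esub> x = restrict (inv_into ?B x) ?B" if "x \<in> Bij ?B" for x
    using that by (rule inv_BijGroup)
  have bb: "bij_betw x ?B ?B" if "x \<in> Bij ?B" for x using that by (simp add: Bij_def)
  show ?thesis
  proof
    show "?H \<subseteq> carrier ?G" by (auto simp: ball_Aut_def BijGroup_def)
    show "\<one>\<^bsub>?G\<^esub> \<in> ?H"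
    proof -
      have i: "holomorphic_map_on (\<lambda>z. z) ?B"
        unfolding holomorphic_map_on_def by (auto intro!: exI[of _ "\<lambda>z. z"])
      have "inv_into ?B (\<lambda>x\<in>?B. x) z = z" if "z \<in> ?B" for z
        using that by (metis bb bij_betw_def id_Bij inv_into_f_f restrict_apply)
      then show ?thesis
        using i by (auto simp: ball_Aut_def BijGroup_def id_Bij intro: holomorphic_map_on_cong[OF i])
    qed
  next
    fix x y assume x: "x \<in> ?H" and y: "y \<in> ?H"
    have B: "x \<in> Bij ?B" "y \<in> Bij ?B" using x y by (auto simp: ball_Aut_def)
    have h: "holomorphic_map_on x ?B" "holomorphic_map_on y ?B"
       "holomorphic_map_on (inv_into ?B x) ?B" "holomorphic_map_on (inv_into ?B y) ?B"
      using x y by (auto simp: ball_Aut_def)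
    have 1: "holomorphic_map_on (compose ?B x y) ?B"
      by (rule holomorphic_map_on_cong[OF holomorphic_map_on_compose[OF h(2) h(1)]])
         (use bb[OF B(2)] in \<open>auto simp: compose_def bij_betw_def\<close>)
    have e: "inv_into ?B y (inv_into ?B x z) = inv_into ?B (compose ?B x y) z" if "z \<in> ?B" for z
    proof -
      define w where "w = inv_into ?B y (inv_into ?B x z)"
      have w: "w \<in> ?B" "y w = inv_into ?B x z"
        unfolding w_def using B that
        by (auto intro!: Bij_inv_into_mem simp del: mem_ball_0 mem_ball)
           (metis Bij_inv_into_mem bb bij_betw_inv_into_right)
      have "compose ?B x y w = z"
        using w that bb[OF B(1)] by (simp add: compose_eq bij_betw_inv_into_right)
      then have "inv_into ?B (compose ?B x y) z = w"
        using w(1) bb[OF compose_Bij[OF B]] by (metis bij_betw_inv_into_left)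
      then show ?thesis by (simp add: w_def)
    qed
    have 2: "holomorphic_map_on (inv_into ?B (compose ?B x y)) ?B"
      by (rule holomorphic_map_on_cong[OF holomorphic_map_on_compose[OF h(3) h(4)]])
         (use e bb[OF B(1)] bij_betw_inv_into[OF bb[OF B(1)]] in \<open>auto simp: bij_betw_def\<close>)
    show "x \<otimes>\<^bsub>?G\<^esub> y \<in> ?H"
      using 1 2 compose_Bij[OF B] B by (simp add: ball_Aut_def BijGroup_def)
  next
    fix x assume x: "x \<in> ?H"
    have B: "x \<in> Bij ?B" using x by (auto simp: ball_Aut_def)
    have h: "holomorphic_map_on x ?B" "holomorphic_map_on (inv_into ?B x) ?B"
      using x by (auto simp: ball_Aut_def)
    let ?r = "restrict (inv_into ?B x) ?B"
    have 1: "holomorphic_map_on ?r ?B"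
      by (rule holomorphic_map_on_cong[OF h(2)]) auto
    have "inv_into ?B ?r z = x z" if "z \<in> ?B" for z
    proof -
      have "x z \<in> ?B" using that bb[OF B] by (meson bij_betwE)
      moreover have "?r (x z) = z" using that bb[OF B] calculation
        by (simp add: bij_betw_inv_into_left)
      ultimately show ?thesis
        using bb[OF restrict_inv_into_Bij[OF B]] by (metis bij_betw_inv_into_left)
    qed
    then have 2: "holomorphic_map_on (inv_into ?B ?r) ?B"
      by (intro holomorphic_map_on_cong[OF h(1)]) auto
    show "inv\<^bsub>?G\<^esub> x \<in> ?H"
      unfolding inveq[OF B] using 1 2 restrict_inv_into_Bij[OF B] by (simp add: ball_Aut_def)
  qed
qed

lemma group_ball_Aut: "group ball_Aut"
proof -
  have "ball_Aut = (BijGroup unit_ball)\<lparr>carrier := carrier ball_Aut\<rparr>"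
    by (simp add: ball_Aut_def)
  then show ?thesis
    using subgroup.subgroup_is_group[OF subgroup_ball_Aut_BijGroup group_BijGroup] by metis
qed

lemma diagonal_torus_subset_ball_Aut:
  "(diagonal_torus :: (complex ^ 'n \<Rightarrow> complex ^ 'n) set) \<subseteq> carrier ball_Aut"
proof
  fix t :: "complex ^ 'n \<Rightarrow> complex ^ 'n" assume asm: "t \<in> diagonal_torus"
  let ?B = "unit_ball :: (complex ^ 'n) set"
  from asm obtain u where t: "t = (\<lambda>z\<in>?B. \<chi> i. u i * z $ i)" and u: "\<And>i. norm (u i) = 1"
    unfolding diagonal_torus_def by blast
  let ?s = "\<lambda>z :: complex ^ 'n. \<chi> i. inverse (u i) * z $ i"
  have nt: "norm (\<chi> i. v i * z $ i) = norm z" if "\<And>i. norm (v i) = 1" for v and z :: "complex ^ 'n"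
    using that by (simp add: norm_vec_def norm_mult)
  have u0: "u i \<noteq> 0" for i using u[of i] by auto
  have st: "?s (t z) = z" "t (?s z) = z" "t z \<in> ?B" "?s z \<in> ?B" if "z \<in> ?B" for z
    using that u u0 nt[of u z] nt[of "\<lambda>i. inverse (u i)" z] 
    by (auto simp: t vec_eq_iff norm_inverse)
  have b: "bij_betw t ?B ?B"
    by (rule bij_betw_byWitness[of _ ?s]) (use st in blast)+
  have "inv_into ?B t z = ?s z" if "z \<in> ?B" for z
    using st[OF that] b by (metis bij_betw_inv_into_left)
  then have "holomorphic_map_on (inv_into ?B t) ?B"
    by (intro holomorphic_map_on_cong[OF holomorphic_map_on_diagonal[of "\<lambda>i. inverse (u i)"]]) auto
  moreover have "holomorphic_map_on t ?B"
    by (rule holomorphic_map_on_cong[OF holomorphic_map_on_diagonal[of u]]) (auto simp: t)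
  ultimately show "t \<in> carrier ball_Aut"
    using b by (auto simp: ball_Aut_def Bij_def t)
qed

end

theory Submission
  imports Defs "HOL-Complex_Analysis.Conformal_Mappings"
    "HOL-Computational_Algebra.Fundamental_Theorem_Algebra"
begin

text \<open>
  Suppose that a conjugate of the diagonal torus lies in the invariant group of \<open>f\<close>.  Composing \<open>f\<close>
  with the conjugating automorphism gives a map \<open>h\<close> with \<open>h (u z) = \<psi>\<^sub>u (h z)\<close> for every diagonal
  unitary \<open>u\<close>, with automorphisms \<open>\<psi>\<^sub>u\<close> of the target ball.  As \<open>u\<close> fixes the origin, all \<open>\<psi>\<^sub>u\<close>
  fix the same point \<open>h 0\<close>.  The automorphism group of the ball is transitive (lemma
  \<open>moebius_ball_Aut\<close>), so after composition with an automorphism of the target there is a map \<open>F\<close>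
  with \<open>F 0 = 0\<close> and \<open>F (u z) = \<Phi>\<^sub>u (F z)\<close>, where \<open>\<Phi>\<^sub>u\<close> fixes the origin.  By Cartan's theorem
  (lemma \<open>ball_Aut_fix_0_linear\<close>), \<open>\<Phi>\<^sub>u\<close> is the restriction of a linear isometry.

  The torus being commutative, these isometries commute on the span \<open>W\<close> of the image of \<open>F\<close>.  There
  is thus an orthonormal basis of the target space consisting of common eigenvectors in \<open>W\<close> and of
  vectors orthogonal to \<open>W\<close> (lemma \<open>adapted_orthonormal_basis\<close>).  The corresponding unitary change
  of coordinates is an automorphism of the ball, and in the new coordinates each component of \<open>F\<close>
  is multiplied by a scalar when its argument is rotated by an element of the torus.  A holomorphic
  function with this property is a constant times a monomial (lemma \<open>semi_invariant_is_monomial\<close>):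
  in each variable the Taylor coefficients of different degrees scale by different characters of the
  circle, so at most one of them is nonzero.

  Conversely, a diagonal unitary of the source acts on a monomial map as a diagonal unitary of the
  target, and this symmetry carries over to every spherically equivalent map.
\<close>

section \<open>The Hermitian inner product\<close>

definition herm :: "complex ^ 'm \<Rightarrow> complex ^ 'm \<Rightarrow> complex"
  where "herm x y = (\<Sum>j\<in>UNIV. x $ j * cnj (y $ j))"

lemma herm_add_left: "herm (x + y) z = herm x z + herm y z"
  and herm_diff_left: "herm (x - y) z = herm x z - herm y z"
  and herm_smult_left: "herm (c *s x) z = c * herm x z"
  and herm_add_right: "herm z (x + y) = herm z x + herm z y"
  and herm_diff_right: "herm z (x - y) = herm z x - herm z y"
  and herm_smult_right: "herm z (c *s x) = cnj c * herm z x"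
  and herm_zero_left: "herm 0 z = 0"
  and herm_zero_right: "herm z 0 = 0"
  by (simp_all add: herm_def sum.distrib sum_subtractf sum_distrib_left algebra_simps)

lemma herm_sum_left: "herm (\<Sum>i\<in>A. x i) z = (\<Sum>i\<in>A. herm (x i) z)"
  by (induction A rule: infinite_finite_induct) (simp_all add: herm_zero_left herm_add_left)

lemmas herm_simps = herm_add_left herm_diff_left herm_smult_left herm_add_right herm_diff_right
  herm_smult_right herm_zero_left herm_zero_right

lemma cnj_herm: "cnj (herm x y) = herm y x"
  by (simp add: herm_def mult.commute)

lemma herm_eq_0_commute: "herm x y = 0 \<longleftrightarrow> herm y x = 0"
  using cnj_herm complex_cnj_zero by metis

lemma Re_herm: "Re (herm x y) = x \<bullet> y"
  by (simp add: herm_def inner_vec_def inner_complex_def)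

lemma herm_self: "herm x x = of_real ((norm x)\<^sup>2)"
proof -
  have "Im (herm x x) = 0"
    using cnj_herm[of x x] by (simp add: complex_eq_iff)
  then show ?thesis
    by (simp add: complex_eq_iff Re_herm power2_norm_eq_inner)
qed

lemma norm_smult_vec: "norm (c *s x) = norm c * norm (x :: complex ^ 'm)"
proof -
  have "(of_real ((norm (c *s x))\<^sup>2) :: complex) = (c * cnj c) * of_real ((norm x)\<^sup>2)"
    unfolding herm_self[symmetric] by (simp add: herm_simps)
  also have "\<dots> = of_real ((norm c * norm x)\<^sup>2)"
    by (simp add: complex_norm_square[symmetric] power_mult_distrib)
  finally show ?thesis
    by (metis norm_ge_zero mult_nonneg_nonneg of_real_eq_iff power2_eq_imp_eq)
qed

lemma scaleR_eq_smult: "r *\<^sub>R (x :: complex ^ 'm) = of_real r *s x"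
  by (simp add: vec_eq_iff scaleR_conv_of_real[symmetric])

lemma norm_herm_le: "norm (herm x y) \<le> norm x * norm y"
proof -
  \<comment> \<open>Rotating \<open>x\<close> by a unit scalar makes the product real and nonnegative, so that the real
    Cauchy--Schwarz inequality applies.\<close>
  obtain c where c: "norm c = 1" "c * herm x y = of_real (norm (herm x y))"
  proof (cases "herm x y = 0")
    case False
    show ?thesis
      by (rule that[of "cnj (herm x y) / norm (herm x y)"])
        (use False in \<open>simp_all add: norm_divide complex_norm_square power2_eq_square mult.commute
           divide_simps del: of_real_mult, simp add: complex_norm_square[symmetric] power2_eq_square\<close>)
  qed (auto intro: that[of 1])
  have "norm (herm x y) = Re (herm (c *s x) y)"
    by (simp add: herm_simps c)
  also have "\<dots> \<le> norm (c *s x) * norm y"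
    unfolding Re_herm by (rule norm_cauchy_schwarz)
  finally show ?thesis
    by (simp add: norm_smult_vec c)
qed

lemma bounded_linear_herm: "bounded_linear (\<lambda>x. herm x y)"
  by (rule bounded_linear_intro[of _ "norm y"])
    (simp_all add: herm_simps scaleR_eq_smult norm_herm_le, simp add: scaleR_conv_of_real)

text \<open>The equality case of the Cauchy--Schwarz inequality: the hypotheses make the squared norm of
  the difference of the two sides expand to zero.\<close>

lemma eq_of_herm_eq:
  assumes "herm x w = c" "norm w = 1" "norm x = norm c"
  shows "x = c *s w"
proof -
  have "of_real ((norm (x - c *s w))\<^sup>2) = herm (x - c *s w) (x - c *s w)"
    by (simp only: herm_self)
  also have "\<dots> = herm x x - c * cnj (herm x w) - cnj c * herm x w + c * cnj c * herm w w"
    by (simp add: herm_simps cnj_herm algebra_simps)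
  also have "\<dots> = 0"
    using assms by (simp add: herm_self complex_norm_square[symmetric] algebra_simps)
  finally show ?thesis
    by simp
qed

section \<open>Norm-preserving maps of the ball\<close>

text \<open>Pairing with a fixed vector and restricting to a complex line reduces questions about maps
  between balls to holomorphic functions of one variable.\<close>

lemma holomorphic_on_line:
  assumes F: "holomorphic_map_on F S"
    and sub: "\<And>\<zeta>. \<zeta> \<in> T \<Longrightarrow> a + \<zeta> *s v \<in> S"
  shows "(\<lambda>\<zeta>. herm (F (a + \<zeta> *s v)) w) holomorphic_on T"
  unfolding holomorphic_on_def
proof
  fix \<zeta> assume \<zeta>: "\<zeta> \<in> T"
  obtain D where D: "(F has_derivative D) (at (a + \<zeta> *s v) within S)" "\<And>c v. D (c *s v) = c *s D v"
    using F sub[OF \<zeta>] unfolding holomorphic_map_on_def by blast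
  have lin: "bounded_linear (\<lambda>\<zeta>. \<zeta> *s v)"
    by (rule bounded_linear_intro[of _ "norm v"])
      (simp_all add: vec.scale_left_distrib scaleR_eq_smult scaleR_conv_of_real[where 'a=complex]
        norm_smult_vec)
  have 1: "((\<lambda>\<zeta>. a + \<zeta> *s v) has_derivative (\<lambda>t. t *s v)) (at \<zeta> within T)"
    using has_derivative_add[OF has_derivative_const bounded_linear_imp_has_derivative[OF lin]] by auto
  have 2: "((\<lambda>\<zeta>. F (a + \<zeta> *s v)) has_derivative (\<lambda>t. D (t *s v))) (at \<zeta> within T)"
    using has_derivative_in_compose[OF 1 has_derivative_subset[OF D(1)]] sub by auto
  have "((\<lambda>\<zeta>. herm (F (a + \<zeta> *s v)) w) has_derivative (\<lambda>t. herm (D (t *s v)) w)) (at \<zeta> within T)"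
    by (rule bounded_linear.has_derivative[OF bounded_linear_herm 2])
  moreover have "(\<lambda>t. herm (D (t *s v)) w) = (*) (herm (D v) w)"
    by (auto simp: D(2) herm_simps)
  ultimately show "(\<lambda>\<zeta>. herm (F (a + \<zeta> *s v)) w) field_differentiable (at \<zeta> within T)"
    unfolding field_differentiable_def has_field_derivative_def by auto
qed

text \<open>The one-variable Schwarz lemma on the disc through \<open>z\<close>, applied to the component of
  \<open>\<Phi>\<close> in the direction of \<open>\<Phi> z\<close>.\<close>

lemma Schwarz_ball:
  fixes \<Phi> :: "complex ^ 'n \<Rightarrow> complex ^ 'm"
  assumes hol: "holomorphic_map_on \<Phi> unit_ball" and maps: "\<And>z. norm z < 1 \<Longrightarrow> norm (\<Phi> z) < 1"
    and 0: "\<Phi> 0 = 0" and z: "norm z < 1"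
  shows "norm (\<Phi> z) \<le> norm z"
proof (cases "z = 0 \<or> \<Phi> z = 0")
  case False
  define v where "v = of_real (inverse (norm z)) *s z"
  define w where "w = of_real (inverse (norm (\<Phi> z))) *s \<Phi> z"
  define h where "h \<zeta> = herm (\<Phi> (0 + \<zeta> *s v)) w" for \<zeta>
  have v: "norm v = 1" and w: "norm w = 1"
    using False by (simp_all add: v_def w_def norm_smult_vec norm_inverse)
  have "h holomorphic_on ball 0 1"
    unfolding h_def by (rule holomorphic_on_line[OF hol]) (simp_all add: norm_smult_vec v)
  moreover have "norm (h \<zeta>) < 1" if "norm \<zeta> < 1" for \<zeta>
    unfolding h_def
    using norm_herm_le[of "\<Phi> (0 + \<zeta> *s v)" w] maps[of "\<zeta> *s v"] that by (simp add: w norm_smult_vec v)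
  ultimately have le: "norm (h (of_real (norm z))) \<le> norm z"
    using Schwarz_Lemma(1)[of h "of_real (norm z)"] z by (simp add: h_def 0 herm_simps)
  have "0 + of_real (norm z) *s v = z"
    using False by (simp add: v_def vec_eq_iff)
  then have "h (of_real (norm z)) = of_real (norm (\<Phi> z))"
    using False by (simp add: h_def w_def herm_simps herm_self power2_eq_square)
  then show ?thesis
    using le by simp
qed (auto simp: 0)

text \<open>On the disc through \<open>z\<close>, the component of \<open>\<Phi>\<close> in the direction of \<open>\<Phi> z\<close> attains
  equality in the Schwarz lemma, hence is the identity of the disc.  Since \<open>\<Phi>\<close> preserves norms,
  this component is already all of \<open>\<Phi>\<close>.\<close>

lemma norm_preserving_radial:
  fixes \<Phi> :: "complex ^ 'n \<Rightarrow> complex ^ 'm"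
  assumes hol: "holomorphic_map_on \<Phi> unit_ball"
    and norm: "\<And>z. norm z < 1 \<Longrightarrow> norm (\<Phi> z) = norm z"
    and z: "norm z < 1" and t: "0 \<le> t" "t \<le> 1"
  shows "\<Phi> (t *\<^sub>R z) = t *\<^sub>R \<Phi> z"
proof (cases "z = 0")
  case True
  then show ?thesis using norm[of 0] by simp
next
  case False
  define v where "v = of_real (inverse (norm z)) *s z"
  define w where "w = of_real (inverse (norm z)) *s \<Phi> z"
  define h where "h \<zeta> = herm (\<Phi> (0 + \<zeta> *s v)) w" for \<zeta>
  have v: "norm v = 1" and w: "norm w = 1"
    using False norm[OF z] by (simp_all add: v_def w_def norm_smult_vec norm_inverse)
  have n\<Phi>: "norm (\<Phi> (\<zeta> *s v)) = norm \<zeta>" if "norm \<zeta> < 1" for \<zeta>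
    using norm[of "\<zeta> *s v"] that by (simp add: norm_smult_vec v)
  have 1: "h holomorphic_on ball 0 1"
    unfolding h_def by (rule holomorphic_on_line[OF hol]) (simp_all add: norm_smult_vec v)
  have 2: "norm (h \<zeta>) < 1" if "norm \<zeta> < 1" for \<zeta>
    unfolding h_def
    using norm_herm_le[of "\<Phi> (0 + \<zeta> *s v)" w] n\<Phi>[OF that] that by (simp add: w)
  have 0: "h 0 = 0"
    using norm[of 0] by (simp add: h_def herm_simps)
  have zv: "of_real (norm z) *s v = z"
    using False by (simp add: v_def vec_eq_iff)
  have hz: "h (of_real (norm z)) = of_real (norm z)"
    using False norm[OF z] zv by (simp add: h_def w_def herm_simps herm_self power2_eq_square)
  have "\<exists>\<zeta>. norm \<zeta> < 1 \<and> \<zeta> \<noteq> 0 \<and> norm (h \<zeta>) = norm \<zeta>"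
    by (rule exI[of _ "of_real (norm z)"]) (use False z hz in auto)
  then obtain \<alpha> where \<alpha>: "\<And>\<zeta>. norm \<zeta> < 1 \<Longrightarrow> h \<zeta> = \<alpha> * \<zeta>"
    using Schwarz_Lemma(3)[OF 1 0 2, of 0] by force
  have "\<alpha> = 1"
    using \<alpha>[of "of_real (norm z)"] hz z False by simp
  have *: "\<Phi> (\<zeta> *s v) = \<zeta> *s w" if "norm \<zeta> < 1" for \<zeta>
    by (rule eq_of_herm_eq) (use \<alpha>[OF that] \<open>\<alpha> = 1\<close> n\<Phi>[OF that] w in \<open>auto simp: h_def\<close>)
  have "t * norm z < 1"
    using z t by (smt (verit) mult_left_le_one_le norm_ge_zero)
  then have "\<Phi> (of_real (t * norm z) *s v) = of_real (t * norm z) *s w"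
    using t by (intro *) (simp add: abs_mult norm_mult)
  moreover have "of_real (t * norm z) *s v = t *\<^sub>R z" "of_real (t * norm z) *s w = t *\<^sub>R \<Phi> z"
    using False by (simp_all add: v_def w_def scaleR_eq_smult)
  ultimately show ?thesis
    by simp
qed

text \<open>By homogeneity along rays, the difference quotient of \<open>\<Phi>\<close> at the origin in the direction
  \<open>z\<close> is constantly \<open>\<Phi> z\<close>, so \<open>\<Phi>\<close> coincides with its derivative at the origin.\<close>

lemma norm_preserving_eq_linear:
  fixes \<Phi> :: "complex ^ 'n \<Rightarrow> complex ^ 'm"
  assumes hol: "holomorphic_map_on \<Phi> unit_ball"
    and norm: "\<And>z. norm z < 1 \<Longrightarrow> norm (\<Phi> z) = norm z"
  obtains L where "Vector_Spaces.linear (*s) (*s) L" "\<And>x. norm (L x) = norm x"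
    "\<And>z. norm z < 1 \<Longrightarrow> \<Phi> z = L z"
proof -
  obtain D where D: "(\<Phi> has_derivative D) (at 0 within unit_ball)" "\<And>c v. D (c *s v) = c *s D v"
    using hol unfolding holomorphic_map_on_def by (metis centre_in_ball zero_less_one)
  interpret D: bounded_linear D using D(1) by (rule has_derivative_bounded_linear)
  have eq: "\<Phi> z = D z" if z: "norm z < 1" for z
  proof -
    have "((\<lambda>t. t *\<^sub>R z) has_derivative (\<lambda>t. t *\<^sub>R z)) (at 0 within {0..1})"
      by (auto intro!: derivative_eq_intros)
    moreover have "(\<lambda>t. t *\<^sub>R z) ` {0..1} \<subseteq> unit_ball"
      using z by (auto intro: le_less_trans[OF mult_left_le_one_le[OF norm_ge_zero]])
    ultimately have "((\<lambda>t. \<Phi> (t *\<^sub>R z)) has_derivative (\<lambda>t. D (t *\<^sub>R z))) (at 0 within {0..1})"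
      using has_derivative_in_compose[of "\<lambda>t. t *\<^sub>R z" _ 0 "{0..1}" \<Phi> D] has_derivative_subset[OF D(1)]
      by simp
    then have "((\<lambda>t. \<Phi> (t *\<^sub>R z)) has_vector_derivative D z) (at 0 within {0..1})"
      unfolding has_vector_derivative_def by (simp add: D.scaleR)
    moreover have "((\<lambda>t. t *\<^sub>R \<Phi> z) has_vector_derivative \<Phi> z) (at 0 within {0..1})"
      by (auto intro!: derivative_eq_intros)
    then have "((\<lambda>t. \<Phi> (t *\<^sub>R z)) has_vector_derivative \<Phi> z) (at 0 within {0..1})"
      by (rule has_vector_derivative_transform[rotated 2])
        (use norm_preserving_radial[OF hol norm z] in auto)
    moreover have "at (0 :: real) within {0..1} \<noteq> bot"
      by (simp add: at_within_Icc_at_right trivial_limit_at_right_real)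
    ultimately show ?thesis
      by (metis vector_derivative_unique_within)
  qed
  have "norm (D x) = norm x" for x
  proof -
    define r where "r = inverse (1 + norm x)"
    have r: "r > 0" "norm (r *\<^sub>R x) < 1"
      by (auto simp: r_def divide_simps add_pos_nonneg)
    have "norm (D (r *\<^sub>R x)) = norm (r *\<^sub>R x)"
      using eq norm r by metis
    then show ?thesis using r(1) by (simp add: D.scaleR)
  qed
  moreover have "Vector_Spaces.linear (*s) (*s) D"
    by (intro Vector_Spaces.linear.intro vec.vector_space_axioms)
      (unfold_locales, auto simp: D.add D(2))
  ultimately show ?thesis using that eq by blast
qed

section \<open>The automorphism group of the ball\<close>

lemma ball_Aut_maps: "\<gamma> \<in> carrier ball_Aut \<Longrightarrow> norm z < 1 \<Longrightarrow> norm (\<gamma> z) < 1"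
  unfolding ball_Aut_def Bij_def bij_betw_def by auto

lemma ball_Aut_holomorphic: "\<gamma> \<in> carrier ball_Aut \<Longrightarrow> holomorphic_map_on \<gamma> unit_ball"
  unfolding ball_Aut_def by simp

lemma ball_Aut_mult:
  "\<lbrakk>\<gamma> \<in> carrier ball_Aut; \<delta> \<in> carrier ball_Aut; norm z < 1\<rbrakk> \<Longrightarrow> (\<gamma> \<otimes>\<^bsub>ball_Aut\<^esub> \<delta>) z = \<gamma> (\<delta> z)"
  unfolding ball_Aut_def BijGroup_def by (simp add: compose_eq)

lemma ball_Aut_one: "norm z < 1 \<Longrightarrow> \<one>\<^bsub>ball_Aut\<^esub> z = z"
  unfolding ball_Aut_def BijGroup_def by simp

lemmas ball_Aut_mult_closed = monoid.m_closed[OF group.is_monoid[OF group_ball_Aut]]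
  and ball_Aut_inv_closed = group.inv_closed[OF group_ball_Aut]

lemma ball_Aut_inv_left:
  "\<gamma> \<in> carrier ball_Aut \<Longrightarrow> norm z < 1 \<Longrightarrow> (inv\<^bsub>ball_Aut\<^esub> \<gamma>) (\<gamma> z) = z"
  by (metis ball_Aut_mult ball_Aut_inv_closed ball_Aut_one group.l_inv group_ball_Aut)

lemma ball_Aut_inv_right:
  "\<gamma> \<in> carrier ball_Aut \<Longrightarrow> norm z < 1 \<Longrightarrow> \<gamma> ((inv\<^bsub>ball_Aut\<^esub> \<gamma>) z) = z"
  by (metis ball_Aut_mult ball_Aut_inv_closed ball_Aut_one group.r_inv group_ball_Aut)

lemma ball_AutI:
  fixes h k :: "complex ^ 'n \<Rightarrow> complex ^ 'n"
  assumes "holomorphic_map_on h unit_ball" "holomorphic_map_on k unit_ball"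
    and "\<And>z. norm z < 1 \<Longrightarrow> norm (h z) < 1" "\<And>z. norm z < 1 \<Longrightarrow> norm (k z) < 1"
    and "\<And>z. norm z < 1 \<Longrightarrow> k (h z) = z" "\<And>z. norm z < 1 \<Longrightarrow> h (k z) = z"
  shows "restrict h unit_ball \<in> carrier ball_Aut"
proof -
  let ?r = "restrict h unit_ball"
  have b: "bij_betw ?r unit_ball unit_ball"
    by (rule bij_betw_byWitness[of _ k]) (use assms in auto)
  have "inv_into unit_ball ?r z = k z" if "z \<in> unit_ball" for z
    using that assms b by (intro inv_into_f_eq) (auto simp: bij_betw_def)
  then have "holomorphic_map_on (inv_into unit_ball ?r) unit_ball"
    by (intro holomorphic_map_on_cong[OF assms(2)]) auto
  moreover have "holomorphic_map_on ?r unit_ball"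
    by (rule holomorphic_map_on_cong[OF assms(1)]) auto
  ultimately show ?thesis
    using b by (auto simp: ball_Aut_def Bij_def)
qed

text \<open>Cartan's theorem for the ball.  The Schwarz lemma for \<open>\<Phi>\<close> and for its inverse shows that
  \<open>\<Phi>\<close> preserves norms.\<close>

lemma ball_Aut_fix_0_linear:
  assumes "\<Phi> \<in> carrier ball_Aut" "\<Phi> 0 = 0"
  obtains L where "Vector_Spaces.linear (*s) (*s) L" "\<And>x. norm (L x) = norm x"
    "\<And>z. norm z < 1 \<Longrightarrow> \<Phi> z = L z"
proof (rule norm_preserving_eq_linear[OF ball_Aut_holomorphic[OF assms(1)]])
  let ?\<Psi> = "inv\<^bsub>ball_Aut\<^esub> \<Phi>"
  have \<Psi>: "?\<Psi> \<in> carrier ball_Aut" "?\<Psi> 0 = 0"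
    using assms ball_Aut_inv_left[OF assms(1), of 0] by (auto intro: ball_Aut_inv_closed)
  fix z :: "complex ^ 'a" assume z: "norm z < 1"
  have "norm (\<Phi> z) \<le> norm z"
    by (rule Schwarz_ball[OF ball_Aut_holomorphic ball_Aut_maps]) (use assms z in auto)
  moreover have "norm (?\<Psi> (\<Phi> z)) \<le> norm (\<Phi> z)"
    by (rule Schwarz_ball[OF ball_Aut_holomorphic ball_Aut_maps])
      (use \<Psi> ball_Aut_maps[OF assms(1) z] in auto)
  ultimately show "norm (\<Phi> z) = norm z"
    using ball_Aut_inv_left[OF assms(1) z] by simp
qed (use that in blast)

section \<open>Semi-invariant functions under the torus are monomials\<close>

text \<open>Comparing the Taylor coefficients of both sides of the functional equation: each nonzero
  coefficient determines the multiplier.\<close>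

lemma semi_invariant_Taylor:
  assumes h: "h holomorphic_on ball 0 r" and "r > 0" and \<tau>: "norm \<tau> = 1"
    and eq: "\<And>\<zeta>. norm \<zeta> < r \<Longrightarrow> h (\<tau> * \<zeta>) = \<mu> * h \<zeta>" and nz: "(deriv ^^ k) h 0 \<noteq> 0"
  shows "\<mu> = \<tau> ^ k"
proof -
  have 1: "(deriv ^^ k) (\<lambda>w. h (\<tau> * w)) 0 = \<tau> ^ k * (deriv ^^ k) h (\<tau> * 0)"
    by (rule higher_deriv_compose_linear[OF h open_ball[of 0 r] open_ball])
      (use \<open>r > 0\<close> \<tau> in \<open>auto simp: norm_mult\<close>)
  have "(deriv ^^ k) (\<lambda>w. h (\<tau> * w)) 0 = (deriv ^^ k) (\<lambda>w. \<mu> * h w) 0"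
    by (rule higher_deriv_transform_within_open[of _ "ball 0 r"])
      (use \<open>r > 0\<close> eq h in \<open>auto intro!: holomorphic_intros intro: holomorphic_transform[of "\<lambda>w. \<mu> * h w"]\<close>)
  also have "\<dots> = \<mu> * (deriv ^^ k) h 0"
    by (rule higher_deriv_cmult[OF h]) (use \<open>r > 0\<close> in auto)
  finally show ?thesis
    using 1 nz by simp
qed

lemma circle_power_inj:
  assumes "\<And>\<tau> :: complex. norm \<tau> = 1 \<Longrightarrow> \<tau> ^ k = \<tau> ^ l"
  shows "k = l"
proof -
  have False if le: "k < l" and eq: "\<And>\<tau> :: complex. norm \<tau> = 1 \<Longrightarrow> \<tau> ^ k = \<tau> ^ l" for k l :: nat
  proof -
    \<comment> \<open>chosen so that \<open>\<tau> ^ (l - k) = -1\<close>\<close>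
    define \<tau> where "\<tau> = cis (pi / real (l - k))"
    have "\<tau> ^ l = \<tau> ^ k * \<tau> ^ (l - k)"
      using le by (simp flip: power_add)
    also have "\<tau> ^ (l - k) = cis (real (l - k) * (pi / real (l - k)))"
      unfolding \<tau>_def by (rule Complex.DeMoivre)
    also have "\<dots> = -1"
      using le by simp
    finally have "\<tau> ^ k = 0"
      using eq[of \<tau>] by (simp add: \<tau>_def)
    then show False
      by (simp add: \<tau>_def)
  qed
  from this[of k l] this[of l k] assms show ?thesis
    by (metis nat_neq_iff)
qed

lemma single_Taylor_term:
  assumes h: "h holomorphic_on ball 0 r" and z: "\<And>k. k \<noteq> m \<Longrightarrow> (deriv ^^ k) h 0 = 0"
    and \<zeta>: "norm \<zeta> < r"
  shows "h \<zeta> = (deriv ^^ m) h 0 / fact m * \<zeta> ^ m"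
proof -
  have "(\<lambda>n. (deriv ^^ n) h 0 / fact n * (\<zeta> - 0) ^ n) sums h \<zeta>"
    by (rule holomorphic_power_series[OF h]) (use \<zeta> in auto)
  moreover have "(\<lambda>n. (deriv ^^ n) h 0 / fact n * (\<zeta> - 0) ^ n) sums
      (\<Sum>n\<in>{m}. (deriv ^^ n) h 0 / fact n * (\<zeta> - 0) ^ n)"
    by (rule sums_finite) (use z in auto)
  ultimately show ?thesis
    by (simp add: sums_iff)
qed

definition vec_upd :: "'a ^ 'n \<Rightarrow> 'n \<Rightarrow> 'a \<Rightarrow> 'a ^ 'n"
  where "vec_upd z i \<zeta> = (\<chi> k. if k = i then \<zeta> else z $ k)"

lemma norm_vec_upd:
  fixes z :: "complex ^ 'n"
  shows "(norm (vec_upd z i \<zeta>))\<^sup>2 = (norm (vec_upd z i 0))\<^sup>2 + (norm \<zeta>)\<^sup>2"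
proof -
  have *: "(norm x)\<^sup>2 = (norm (x $ i))\<^sup>2 + (\<Sum>k\<in>UNIV - {i}. (norm (x $ k))\<^sup>2)" for x :: "complex ^ 'n"
    by (simp add: norm_vec_def L2_set_def sum_nonneg sum.remove[of UNIV i])
  show ?thesis
    unfolding *[of "vec_upd z i _"] by (simp add: vec_upd_def)
qed

lemma vec_upd_line: "vec_upd z i \<zeta> = vec_upd z i 0 + \<zeta> *s axis i (1 :: complex)"
  by (simp add: vec_upd_def vec_eq_iff axis_def)

lemma vec_upd_self: "vec_upd z i (z $ i) = z"
  by (simp add: vec_upd_def vec_eq_iff)

text \<open>The multiplier of a rotation in the \<open>i\<close>-th coordinate does not depend on the slice.  A slice
  on which the function is not zero therefore fixes the exponent \<open>m\<close> for all slices in that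
  direction: a Taylor coefficient of another degree would yield another character of the circle.\<close>

lemma semi_invariant_slices:
  fixes F :: "complex ^ 'n \<Rightarrow> complex ^ 'm"
  assumes F: "holomorphic_map_on F unit_ball"
    and inv: "\<And>u. (\<forall>i. norm (u i) = 1) \<Longrightarrow> \<exists>\<mu>. \<forall>z. norm z < 1 \<longrightarrow> herm (F (\<chi> i. u i * z $ i)) w = \<mu> * herm (F z) w"
    and z0: "norm z0 < 1" "herm (F z0) w \<noteq> 0"
  shows "\<exists>m. \<forall>z. norm z < 1 \<longrightarrow>
    (\<exists>c. \<forall>\<zeta>. norm (vec_upd z i \<zeta>) < 1 \<longrightarrow> herm (F (vec_upd z i \<zeta>)) w = c * \<zeta> ^ m)"
proof -
  define h where "h z \<zeta> = herm (F (vec_upd z i \<zeta>)) w" for z \<zeta>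
  \<comment> \<open>the slice of the ball through \<open>z\<close> in the \<open>i\<close>-th direction is a disc of this radius\<close>
  define r where "r z = sqrt (1 - (norm (vec_upd z i 0))\<^sup>2)" for z :: "complex ^ 'n"
  have in_ball: "norm (vec_upd z i \<zeta>) < 1 \<longleftrightarrow> norm \<zeta> < r z" for z \<zeta>
  proof -
    have "norm (vec_upd z i \<zeta>) < 1 \<longleftrightarrow> (norm (vec_upd z i \<zeta>))\<^sup>2 < 1"
      by (simp add: abs_square_less_1)
    also have "\<dots> \<longleftrightarrow> (norm \<zeta>)\<^sup>2 < 1 - (norm (vec_upd z i 0))\<^sup>2"
      unfolding norm_vec_upd[of z i \<zeta>] by auto
    also have "\<dots> \<longleftrightarrow> norm \<zeta> < r z"
      unfolding r_def by (metis norm_ge_zero real_less_rsqrt real_sqrt_less_iff real_sqrt_abs abs_of_nonneg)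
    finally show ?thesis .
  qed
  have r: "r z > 0" if "norm z < 1" for z
    using in_ball[of z "z $ i"] that by (simp add: vec_upd_self) (meson le_less_trans norm_ge_zero)
  have hol: "h z holomorphic_on ball 0 (r z)" for z
    unfolding h_def by (subst vec_upd_line, rule holomorphic_on_line[OF F])
      (simp_all flip: vec_upd_line add: in_ball)
  have "\<exists>\<mu>. \<forall>z \<zeta>. norm \<zeta> < r z \<longrightarrow> h z (\<tau> * \<zeta>) = \<mu> * h z \<zeta>" if \<tau>: "norm \<tau> = 1" for \<tau>
  proof -
    define u where "u = (\<lambda>k. if k = i then \<tau> else 1)"
    have "\<forall>k. norm (u k) = 1"
      by (simp add: u_def \<tau>)
    then obtain \<mu> where \<mu>: "\<And>z. norm z < 1 \<Longrightarrow> herm (F (\<chi> k. u k * z $ k)) w = \<mu> * herm (F z) w"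
      using inv by blast
    have "(\<chi> k. u k * vec_upd z i \<zeta> $ k) = vec_upd z i (\<tau> * \<zeta>)" for z \<zeta>
      by (simp add: vec_eq_iff vec_upd_def u_def)
    then show ?thesis
      using \<mu> in_ball unfolding h_def by metis
  qed
  then obtain \<mu> where \<mu>: "\<And>\<tau> z \<zeta>. norm \<tau> = 1 \<Longrightarrow> norm \<zeta> < r z \<Longrightarrow> h z (\<tau> * \<zeta>) = \<mu> \<tau> * h z \<zeta>"
    by metis
  have char: "\<mu> \<tau> = \<tau> ^ k" if "norm z < 1" "norm \<tau> = 1" "(deriv ^^ k) (h z) 0 \<noteq> 0" for z \<tau> k
    by (rule semi_invariant_Taylor[OF hol r _ \<mu>]) (use that in auto)
  have "\<exists>m. (deriv ^^ m) (h z0) 0 \<noteq> 0"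
  proof (rule ccontr)
    assume "\<not> ?thesis"
    then have "h z0 (z0 $ i) = 0"
      using single_Taylor_term[OF hol, of 0 z0 "z0 $ i"] in_ball[of z0 "z0 $ i"] z0(1)
      by (auto simp: vec_upd_self dest: spec[of _ 0])
    then show False
      using z0 by (simp add: h_def vec_upd_self)
  qed
  then obtain m where m: "(deriv ^^ m) (h z0) 0 \<noteq> 0" ..
  have "(deriv ^^ k) (h z) 0 = 0" if "norm z < 1" "k \<noteq> m" for z k
    using circle_power_inj[of k m] char[OF that(1)] char[OF z0(1) _ m] that(2) by metis
  then show ?thesis
    using single_Taylor_term[OF hol] in_ball unfolding h_def by metis
qed

text \<open>In every coordinate direction the function is a constant times a power with a fixed exponent.
  Replacing the coordinates of \<open>z\<close> by those of another point one at a time shows that the quotient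
  by the monomial is constant.\<close>

lemma semi_invariant_is_monomial:
  fixes F :: "complex ^ 'n \<Rightarrow> complex ^ 'm"
  assumes F: "holomorphic_map_on F unit_ball"
    and inv: "\<And>u. (\<forall>i. norm (u i) = 1) \<Longrightarrow> \<exists>\<mu>. \<forall>z. norm z < 1 \<longrightarrow> herm (F (\<chi> i. u i * z $ i)) w = \<mu> * herm (F z) w"
  shows "\<exists>c \<alpha>. \<forall>z. norm z < 1 \<longrightarrow> herm (F z) w = c * monom_fun \<alpha> z"
proof (cases "\<exists>z0. norm z0 < 1 \<and> herm (F z0) w \<noteq> 0")
  case False
  then show ?thesis
    by (intro exI[of _ 0]) auto
next
  case True
  then obtain z0 where z0: "norm z0 < 1" "herm (F z0) w \<noteq> 0" by blast
  define \<phi> where "\<phi> z = herm (F z) w" for z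
  obtain \<alpha> where \<alpha>: "\<And>i z. norm z < 1 \<Longrightarrow>
      \<exists>c. \<forall>\<zeta>. norm (vec_upd z i \<zeta>) < 1 \<longrightarrow> \<phi> (vec_upd z i \<zeta>) = c * \<zeta> ^ \<alpha> i"
    using semi_invariant_slices[OF F inv z0] unfolding \<phi>_def by metis
  have step: "\<phi> z * \<zeta> ^ \<alpha> i = \<phi> (vec_upd z i \<zeta>) * (z $ i) ^ \<alpha> i"
    if z: "norm z < 1" and \<zeta>: "norm (vec_upd z i \<zeta>) < 1" for z i \<zeta>
  proof -
    obtain c where c: "\<And>\<zeta>. norm (vec_upd z i \<zeta>) < 1 \<Longrightarrow> \<phi> (vec_upd z i \<zeta>) = c * \<zeta> ^ \<alpha> i"
      using \<alpha>[OF z] by metis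
    show ?thesis
      using c[OF \<zeta>] c[of "z $ i"] z by (simp add: vec_upd_self)
  qed
  \<comment> \<open>Cross-multiplied to allow zero coordinates; the bound on the norms keeps every
    intermediate point of the path in the ball.\<close>
  have many: "\<phi> z * monom_fun \<alpha> z' = \<phi> z' * monom_fun \<alpha> z"
    if sq: "(norm z)\<^sup>2 + (norm z')\<^sup>2 < 1" for z z'
  proof -
    define mix where "mix S = (\<chi> k. if k \<in> S then z' $ k else z $ k)" for S
    have mix: "norm (mix S) < 1" for S
    proof -
      have "(norm (mix S))\<^sup>2 \<le> (norm z)\<^sup>2 + (norm z')\<^sup>2"
        by (auto simp: norm_vec_def L2_set_def sum_nonneg mix_def sum.distrib[symmetric] intro!: sum_mono)
      then have "(norm (mix S))\<^sup>2 < 1\<^sup>2"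
        using sq by simp
      then show ?thesis
        by (rule power2_less_imp_less) simp
    qed
    have "\<phi> z * (\<Prod>i\<in>S. (z' $ i) ^ \<alpha> i) = \<phi> (mix S) * (\<Prod>i\<in>S. (z $ i) ^ \<alpha> i)" for S
    proof (induction S rule: infinite_finite_induct)
      case empty
      have "mix {} = z" by (simp add: mix_def vec_eq_iff)
      then show ?case by simp
    next
      case (insert i S)
      have upd: "vec_upd (mix S) i (z' $ i) = mix (insert i S)"
        by (auto simp: vec_upd_def mix_def vec_eq_iff)
      have "\<phi> (mix S) * (z' $ i) ^ \<alpha> i = \<phi> (mix (insert i S)) * (mix S $ i) ^ \<alpha> i"
        using step[of "mix S" i "z' $ i"] mix unfolding upd by blast
      moreover have "mix S $ i = z $ i"
        using insert by (simp add: mix_def)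
      ultimately have step': "\<phi> (mix S) * (z' $ i) ^ \<alpha> i = \<phi> (mix (insert i S)) * (z $ i) ^ \<alpha> i"
        by simp
      have "\<phi> z * (\<Prod>i\<in>insert i S. (z' $ i) ^ \<alpha> i) = (\<phi> z * (\<Prod>i\<in>S. (z' $ i) ^ \<alpha> i)) * (z' $ i) ^ \<alpha> i"
        using insert.hyps by (simp add: mult_ac)
      also have "\<dots> = (\<phi> (mix S) * (z' $ i) ^ \<alpha> i) * (\<Prod>i\<in>S. (z $ i) ^ \<alpha> i)"
        unfolding insert.IH by (simp only: mult_ac)
      also have "\<dots> = \<phi> (mix (insert i S)) * (\<Prod>i\<in>insert i S. (z $ i) ^ \<alpha> i)"
        unfolding step' using insert.hyps by (simp add: mult_ac)
      finally show ?case .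
    qed simp
    moreover have "mix UNIV = z'"
      by (simp add: mix_def vec_eq_iff)
    ultimately show ?thesis
      unfolding monom_fun_def by metis
  qed
  \<comment> \<open>A base point without zero coordinates.  It has to be small when \<open>z\<close> is close to the sphere,
    so \<open>z\<close> is compared with a small \<open>p s\<close>, and that one with the fixed \<open>p s0\<close>.\<close>
  define p :: "real \<Rightarrow> complex ^ 'n" where "p s = (\<chi> i. of_real s)" for s
  have np: "(norm (p s :: complex ^ 'n))\<^sup>2 = real CARD('n) * s\<^sup>2" for s
    by (simp add: p_def norm_vec_def L2_set_def sum_nonneg)
  have mp: "monom_fun \<alpha> (p s) \<noteq> 0" if "s > 0" for s
    using that by (simp add: monom_fun_def p_def)
  have small: "\<exists>s>0. (norm (p s :: complex ^ 'n))\<^sup>2 < \<epsilon>" if "\<epsilon> > 0" for \<epsilon>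
  proof -
    define s where "s = sqrt (\<epsilon> / (2 * real CARD('n)))"
    have "s > 0" "(norm (p s :: complex ^ 'n))\<^sup>2 = \<epsilon> / 2"
      using that by (simp_all add: s_def np)
    then show ?thesis using that by (intro exI[of _ s]) simp
  qed
  obtain s0 where s0: "s0 > 0" "(norm (p s0 :: complex ^ 'n))\<^sup>2 < 1/2"
    using small[of "1/2"] by auto
  define c where "c = \<phi> (p s0) / monom_fun \<alpha> (p s0)"
  have "\<phi> z = c * monom_fun \<alpha> z" if z: "norm z < 1" for z
  proof -
    have "(norm z)\<^sup>2 < 1"
      using z by (simp add: abs_square_less_1)
    then obtain s where s: "s > 0" "(norm (p s :: complex ^ 'n))\<^sup>2 < min (1/2) (1 - (norm z)\<^sup>2)"
      using small[of "min (1/2) (1 - (norm z)\<^sup>2)"] by auto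
    have "\<phi> z * monom_fun \<alpha> (p s) = \<phi> (p s) * monom_fun \<alpha> z"
      by (rule many) (use s in auto)
    moreover have "\<phi> (p s) * monom_fun \<alpha> (p s0) = \<phi> (p s0) * monom_fun \<alpha> (p s)"
      by (rule many) (use s s0 in auto)
    ultimately have "(\<phi> z * monom_fun \<alpha> (p s0)) * monom_fun \<alpha> (p s) =
        (\<phi> (p s0) * monom_fun \<alpha> z) * monom_fun \<alpha> (p s)"
      by (metis mult.assoc mult.commute)
    then have "\<phi> z * monom_fun \<alpha> (p s0) = \<phi> (p s0) * monom_fun \<alpha> z"
      using mp[OF s(1)] by simp
    then show ?thesis
      using mp[OF s0(1)] by (simp add: c_def field_simps)
  qed
  then show ?thesis
    unfolding \<phi>_def by blast
qed

section \<open>Common eigenvectors of commuting isometries\<close>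

lemma herm_isometry:
  assumes L: "Vector_Spaces.linear (*s) (*s) L" and norm: "\<And>x. norm (L x) = norm x"
  shows "herm (L x) (L y) = herm x y"
proof -
  interpret L: Vector_Spaces.linear "(*s)" "(*s)" L by (rule L)
  have Re: "Re (herm (L x) (L y)) = Re (herm x y)" for x y
    by (simp add: Re_herm dot_norm L.add[symmetric] norm)
  have "Im (herm (L x) (L y)) = - Re (herm (\<i> *s L x) (L y))"
    by (simp add: herm_simps)
  also have "\<dots> = - Re (herm (\<i> *s x) y)"
    by (metis L.scale Re)
  also have "\<dots> = Im (herm x y)"
    by (simp add: herm_simps)
  finally show ?thesis
    using Re by (simp add: complex_eq_iff)
qed

text \<open>Real orthogonality to both \<open>e\<close> and \<open>\<i> *s e\<close> is complex orthogonality to \<open>e\<close>, so a count of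
  real dimensions suffices.\<close>

lemma orthogonal_vector_exists:
  fixes E :: "(complex ^ 'm) set"
  assumes "finite E" "card E < CARD('m)"
  obtains x where "norm x = 1" "\<And>e. e \<in> E \<Longrightarrow> herm x e = 0"
proof -
  let ?S = "E \<union> (*s) \<i> ` E"
  have "card ?S \<le> card E + card E"
    by (meson assms(1) add_left_mono card_Un_le card_image_le order_trans)
  then have "dim ?S < DIM(complex ^ 'm)"
    using dim_le_card'[of ?S] assms by simp
  then obtain x where x: "x \<noteq> 0" "\<And>y. y \<in> span ?S \<Longrightarrow> orthogonal x y"
    using orthogonal_to_subspace_exists by blast
  have "herm x e = 0" if "e \<in> E" for e
  proof -
    have "x \<bullet> e = 0" "x \<bullet> (\<i> *s e) = 0"
      using x(2)[unfolded orthogonal_def] that by (auto intro: span_base)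
    then have "Re (herm x e) = 0" "Re (herm x (\<i> *s e)) = 0"
      by (simp_all only: Re_herm)
    then show ?thesis
      by (simp add: complex_eq_iff herm_simps)
  qed
  then show ?thesis
    using x(1) by (intro that[of "of_real (inverse (norm x)) *s x"])
      (simp_all add: norm_smult_vec herm_simps norm_inverse)
qed

text \<open>The value \<open>p(L) x\<close>, by Horner's scheme.\<close>

definition poly_apply :: "(complex ^ 'm \<Rightarrow> complex ^ 'm) \<Rightarrow> complex ^ 'm \<Rightarrow> complex poly \<Rightarrow> complex ^ 'm"
  where "poly_apply L x p = fold_coeffs (\<lambda>a y. a *s x + L y) p 0"

context
  fixes L :: "complex ^ 'm \<Rightarrow> complex ^ 'm"
  assumes L: "Vector_Spaces.linear (*s) (*s) L"
begin

interpretation L: Vector_Spaces.linear "(*s)" "(*s)" L by (rule L)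

lemma poly_apply_0 [simp]: "poly_apply L x 0 = 0"
  by (simp add: poly_apply_def)

lemma poly_apply_pCons: "poly_apply L x (pCons a p) = a *s x + L (poly_apply L x p)"
  by (cases "p = 0 \<and> a = 0") (auto simp: poly_apply_def L.zero)

lemma poly_apply_add: "poly_apply L x (p + q) = poly_apply L x p + poly_apply L x q"
  by (induction p q rule: poly_induct2)
    (simp_all add: poly_apply_pCons L.add vec.scale_left_distrib)

lemma poly_apply_smult: "poly_apply L x (smult c p) = c *s poly_apply L x p"
  by (induction p) (simp_all add: poly_apply_pCons L.scale vec.scale_right_distrib)

lemma poly_apply_sum: "poly_apply L x (\<Sum>i\<in>A. p i) = (\<Sum>i\<in>A. poly_apply L x (p i))"
  by (induction A rule: infinite_finite_induct) (simp_all add: poly_apply_add)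

lemma poly_apply_monom: "poly_apply L x (monom c i) = c *s (L ^^ i) x"
  by (induction i) (simp_all add: monom_0 monom_Suc poly_apply_pCons L.zero L.scale)

lemma poly_apply_mem:
  assumes "vec.subspace V" "\<And>x. x \<in> V \<Longrightarrow> L x \<in> V" "x \<in> V"
  shows "poly_apply L x p \<in> V"
  by (induction p)
    (simp_all add: poly_apply_pCons assms vec.subspace_0 vec.subspace_add vec.subspace_scale)

lemma annihilating_poly_exists: "\<exists>p. p \<noteq> 0 \<and> poly_apply L x p = 0"
proof (cases "inj_on (\<lambda>i. (L ^^ i) x) {..CARD('m)}")
  case False
  then obtain i j where ij: "i \<noteq> j" "(L ^^ i) x = (L ^^ j) x"
    by (auto simp: inj_on_def)
  have "monom 1 i + monom (-1) j \<noteq> (0 :: complex poly)"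
    using ij(1) by (metis add_eq_0_iff coeff_monom minus_monom one_neq_zero add.inverse_inverse)
  moreover have "poly_apply L x (monom 1 i + monom (-1) j) = 0"
    using ij(2) by (simp add: poly_apply_add poly_apply_monom)
  ultimately show ?thesis by blast
next
  case True
  let ?S = "(\<lambda>i. (L ^^ i) x) ` {..CARD('m)}"
  have "vec.dim ?S \<le> CARD('m)"
    using vec.dim_subset_UNIV[of ?S] by (simp add: vec.dimension_def card_cart_basis)
  then have "vec.dependent ?S"
    by (intro vec.dependent_biggerset_general) (simp add: card_image[OF True])
  then obtain u where u: "\<exists>v\<in>?S. u v \<noteq> 0" "(\<Sum>v\<in>?S. u v *s v) = 0"
    unfolding vec.dependent_finite[OF finite_imageI[OF finite_atMost]] by blast
  define p where "p = (\<Sum>i\<le>CARD('m). monom (u ((L ^^ i) x)) i)"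
  have "coeff p i = u ((L ^^ i) x)" if "i \<le> CARD('m)" for i
    using that by (simp add: p_def coeff_sum)
  then have "p \<noteq> 0"
    using u(1) by auto
  moreover have "poly_apply L x p = 0"
    using u(2) by (simp add: p_def poly_apply_sum poly_apply_monom sum.reindex[OF True])
  ultimately show ?thesis by blast
qed

text \<open>Split off linear factors of an annihilating polynomial of \<open>x\<close> until the remaining factor no
  longer annihilates \<open>x\<close>; its value at \<open>x\<close> is an eigenvector.\<close>

lemma eigenvector_exists:
  assumes V: "vec.subspace V" "\<And>x. x \<in> V \<Longrightarrow> L x \<in> V" and x: "x \<in> V" "x \<noteq> 0"
  obtains y \<mu> where "y \<in> V" "y \<noteq> 0" "L y = \<mu> *s y"
proof -
  have "\<exists>y\<in>V. y \<noteq> 0 \<and> (\<exists>\<mu>. L y = \<mu> *s y)" if "p \<noteq> 0" "poly_apply L x p = 0" for p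
    using that
  proof (induction "degree p" arbitrary: p)
    case 0
    then obtain c where "p = [:c:]" by (metis degree_eq_zeroE)
    then show ?case
      using 0 x by (simp add: poly_apply_pCons L.zero)
  next
    case (Suc n)
    then obtain a where "poly p a = 0"
      using Fundamental_Theorem_Algebra.fundamental_theorem_of_algebra[of p] by (auto simp: constant_degree)
    then obtain q where q: "p = [:-a, 1:] * q"
      by (metis dvdE poly_eq_0_iff_dvd)
    have "p = pCons 0 q + smult (-a) q"
      by (simp add: q)
    then have "poly_apply L x p = L (poly_apply L x q) - a *s poly_apply L x q"
      by (simp only: poly_apply_add poly_apply_smult poly_apply_pCons) simp
    then have eq: "L (poly_apply L x q) = a *s poly_apply L x q"
      using Suc.prems(2) by simp
    have "q \<noteq> 0" using Suc.prems q by auto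
    then have "degree q = n"
      using Suc.hyps(2) degree_mult_eq[of "[:-a, 1:]" q] unfolding q by simp
    show ?case
      using Suc.hyps(1)[of q] \<open>q \<noteq> 0\<close> \<open>degree q = n\<close> eq poly_apply_mem[OF V x(1)]
      by (cases "poly_apply L x q = 0") auto
  qed
  then show ?thesis
    using annihilating_poly_exists that by metis
qed

end

text \<open>If some \<open>L u\<close> is not a scalar on \<open>V\<close>, then one of its eigenspaces in \<open>V\<close> is a proper
  nonzero subspace, invariant under the whole family by commutativity: induction on the dimension.\<close>

lemma common_eigenvector_exists:
  fixes L :: "'u \<Rightarrow> complex ^ 'm \<Rightarrow> complex ^ 'm"
  assumes lin: "\<And>u. u \<in> U \<Longrightarrow> Vector_Spaces.linear (*s) (*s) (L u)"
    and V: "vec.subspace V" "\<And>u x. u \<in> U \<Longrightarrow> x \<in> V \<Longrightarrow> L u x \<in> V"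
    and comm: "\<And>u u' x. u \<in> U \<Longrightarrow> u' \<in> U \<Longrightarrow> x \<in> V \<Longrightarrow> L u (L u' x) = L u' (L u x)"
    and nz: "V \<noteq> {0}"
  shows "\<exists>y\<in>V. y \<noteq> 0 \<and> (\<forall>u\<in>U. \<exists>\<mu>. L u y = \<mu> *s y)"
  using V comm nz
proof (induction "vec.dim V" arbitrary: V rule: less_induct)
  case less
  obtain x where x: "x \<in> V" "x \<noteq> 0"
    using less.prems(1,4) vec.subspace_0 by blast
  show ?case
  proof (cases "\<forall>u\<in>U. \<exists>\<mu>. \<forall>y\<in>V. L u y = \<mu> *s y")
    case True
    then show ?thesis using x by blast
  next
    case False
    then obtain u where u: "u \<in> U" "\<And>\<mu>. \<exists>y\<in>V. L u y \<noteq> \<mu> *s y" by blast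
    interpret L: Vector_Spaces.linear "(*s)" "(*s)" "L u" by (rule lin[OF u(1)])
    obtain y \<mu> where y: "y \<in> V" "y \<noteq> 0" "L u y = \<mu> *s y"
      using eigenvector_exists[OF lin less.prems(1) less.prems(2) x] u(1) by metis
    define V' where "V' = {x \<in> V. L u x = \<mu> *s x}"
    have sub: "vec.subspace V'"
      using less.prems(1) unfolding V'_def vec.subspace_def
      by (auto simp: L.add L.scale L.zero vec.scale_right_distrib mult.commute)
    have "V' \<subset> V" using u(2)[of \<mu>] by (auto simp: V'_def)
    then have "vec.dim V' < vec.dim V"
      using vec.subspace_dim_equal[OF sub less.prems(1)] by (metis linorder_not_le psubset_eq)
    moreover have "L v x \<in> V'" if "v \<in> U" "x \<in> V'" for v x
    proof -
      interpret Lv: Vector_Spaces.linear "(*s)" "(*s)" "L v" by (rule lin[OF that(1)])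
      show ?thesis
        using that less.prems(2) less.prems(3)[OF u(1) that(1)] by (simp add: V'_def Lv.scale)
    qed
    moreover have "V' \<noteq> {0}" using y by (auto simp: V'_def)
    ultimately have "\<exists>y\<in>V'. y \<noteq> 0 \<and> (\<forall>u\<in>U. \<exists>\<mu>. L u y = \<mu> *s y)"
      using less.hyps[of V'] sub less.prems(3) by (auto simp: V'_def)
    then show ?thesis by (auto simp: V'_def)
  qed
qed

definition orthonormal :: "(complex ^ 'm) set \<Rightarrow> bool"
  where "orthonormal E \<longleftrightarrow> (\<forall>e\<in>E. \<forall>e'\<in>E. herm e e' = (if e = e' then 1 else 0))"

lemma orthonormal_norm:
  assumes "orthonormal E" "e \<in> E"
  shows "norm e = 1"
proof -
  have "of_real ((norm e)\<^sup>2) = (1 :: complex)"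
    using assms herm_self[of e] by (simp add: orthonormal_def)
  then have "(norm e)\<^sup>2 = 1"
    using of_real_eq_1_iff by blast
  then show ?thesis
    by (intro power2_eq_imp_eq[of "norm e" 1]) simp_all
qed

lemma orthonormal_insert:
  assumes "orthonormal E" "norm x = 1" "\<And>e. e \<in> E \<Longrightarrow> herm x e = 0"
  shows "orthonormal (insert x E)" "x \<notin> E"
proof -
  show "x \<notin> E"
    using assms(2) assms(3)[of x] by (auto simp: herm_self)
  moreover have "herm e x = 0" if "e \<in> E" for e
    using assms(3)[OF that] herm_eq_0_commute by blast
  ultimately show "orthonormal (insert x E)"
    using assms unfolding orthonormal_def by (auto simp: herm_self)
qed

text \<open>Commutativity is available on \<open>W\<close> only.  The basis is built one vector at a time, each
  vector being a common eigenvector in \<open>W\<close> or orthogonal to \<open>W\<close>.  While the vectors found so far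
  have a nonzero orthogonal complement in \<open>W\<close>, that complement is invariant and contains a further
  common eigenvector; once those in \<open>W\<close> span it, every vector orthogonal to them is orthogonal
  to \<open>W\<close>.\<close>

lemma adapted_orthonormal_basis:
  fixes L :: "'u \<Rightarrow> complex ^ 'm \<Rightarrow> complex ^ 'm"
  assumes lin: "\<And>u. u \<in> U \<Longrightarrow> Vector_Spaces.linear (*s) (*s) (L u)"
    and norm: "\<And>u x. u \<in> U \<Longrightarrow> norm (L u x) = norm x"
    and W: "vec.subspace W" "\<And>u x. u \<in> U \<Longrightarrow> x \<in> W \<Longrightarrow> L u x \<in> W"
    and comm: "\<And>u u' x. u \<in> U \<Longrightarrow> u' \<in> U \<Longrightarrow> x \<in> W \<Longrightarrow> L u (L u' x) = L u' (L u x)"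
  shows "\<exists>E. finite E \<and> card E = CARD('m) \<and> orthonormal E \<and>
    (\<forall>e\<in>E. \<forall>u\<in>U. \<exists>\<mu>. \<forall>x\<in>W. herm (L u x) e = \<mu> * herm x e)"
proof -
  define eig where "eig e \<longleftrightarrow> e \<in> W \<and> (\<forall>u\<in>U. \<exists>\<mu>. L u e = \<mu> *s e)" for e
  define perp where "perp e \<longleftrightarrow> (\<forall>x\<in>W. herm x e = 0)" for e
  have eig: "\<exists>\<mu>. \<forall>x. herm (L u x) e = \<mu> * herm x e" if e: "eig e" "norm e = 1" and u: "u \<in> U" for e u
  proof -
    obtain \<mu> where \<mu>: "L u e = \<mu> *s e"
      using e(1) u unfolding eig_def by blast
    then have "norm \<mu> = 1" using norm[OF u, of e] e(2) by (simp add: norm_smult_vec)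
    then have "\<mu> \<noteq> 0" by auto
    have "cnj \<mu> * herm (L u x) e = herm x e" for x
      using herm_isometry[OF lin norm, OF u u, of x e] \<mu> by (simp add: herm_simps)
    then show ?thesis
      using \<open>\<mu> \<noteq> 0\<close> by (intro exI[of _ "inverse (cnj \<mu>)"]) (metis complex_cnj_zero_iff
        left_inverse mult.assoc mult_1)
  qed
  have ex: "\<exists>E. finite E \<and> card E = k \<and> orthonormal E \<and> (\<forall>e\<in>E. eig e \<or> perp e)"
    if "k \<le> CARD('m)" for k
    using that
  proof (induction k)
    case 0
    show ?case by (intro exI[of _ "{}"]) (auto simp: orthonormal_def)
  next
    case (Suc k)
    then obtain E where E: "finite E" "card E = k" "orthonormal E" "\<And>e. e \<in> E \<Longrightarrow> eig e \<or> perp e"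
      by auto
    note E1 = orthonormal_norm[OF E(3)]
    have "\<exists>y. norm y = 1 \<and> (\<forall>e\<in>E. herm y e = 0) \<and> (eig y \<or> perp y)"
    proof (cases "{x \<in> W. \<forall>e\<in>E. herm x e = 0} = {0}")
      case False
      let ?V = "{x \<in> W. \<forall>e\<in>E. herm x e = 0}"
      have "L u x \<in> ?V" if u: "u \<in> U" and x: "x \<in> ?V" for u x
      proof -
        have "herm (L u x) e = 0" if "e \<in> E" for e
          using E(4)[OF that]
        proof
          assume "eig e"
          then show ?thesis using eig[OF _ E1 u] that x by fastforce
        next
          assume "perp e"
          then show ?thesis using W(2)[OF u] x by (auto simp: perp_def)
        qed
        then show ?thesis using W(2) x u by auto
      qed
      moreover have "vec.subspace ?V"
        using W(1) by (auto simp: vec.subspace_def herm_simps)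
      ultimately obtain y where y: "y \<in> ?V" "y \<noteq> 0" "\<forall>u\<in>U. \<exists>\<mu>. L u y = \<mu> *s y"
        using common_eigenvector_exists[of U L ?V] lin comm False by auto
      let ?y = "of_real (inverse (norm y)) *s y"
      have scale: "L u ?y = of_real (inverse (norm y)) *s L u y" if "u \<in> U" for u
      proof -
        interpret L: Vector_Spaces.linear "(*s)" "(*s)" "L u" by (rule lin[OF that])
        show ?thesis by (rule L.scale)
      qed
      have "\<exists>\<mu>. L u ?y = \<mu> *s ?y" if u: "u \<in> U" for u
      proof -
        obtain \<mu> where "L u y = \<mu> *s y"
          using y(3) u by blast
        then have "L u ?y = \<mu> *s ?y"
          using scale[OF u] by (simp only: vec.scale_left_commute)
        then show ?thesis ..
      qed
      moreover have "?y \<in> W"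
        using y(1) W(1) by (simp add: vec.subspace_scale)
      ultimately have "eig ?y"
        unfolding eig_def by blast
      then show ?thesis
        using y by (intro exI[of _ ?y]) (auto simp: norm_smult_vec norm_inverse herm_simps)
    next
      case True
      obtain y where y: "norm y = 1" "\<And>e. e \<in> E \<Longrightarrow> herm y e = 0"
        using orthogonal_vector_exists[of E] E Suc.prems by auto
      have "herm x y = 0" if x: "x \<in> W" for x
      proof -
        define x' where "x' = x - (\<Sum>e\<in>E \<inter> W. herm x e *s e)"
        have x'W: "x' \<in> W"
          unfolding x'_def using W(1) x
          by (intro vec.subspace_diff vec.subspace_sum vec.subspace_scale) auto
        moreover have "herm x' e = 0" if e: "e \<in> E" for e
        proof (cases "e \<in> W")
          case True
          have "herm x' e = herm x e - (\<Sum>d\<in>E \<inter> W. herm x d * herm d e)"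
            by (simp add: x'_def herm_simps herm_sum_left)
          also have "(\<Sum>d\<in>E \<inter> W. herm x d * herm d e) = (\<Sum>d\<in>E \<inter> W. if d = e then herm x d else 0)"
            by (rule sum.cong) (use E(3) e in \<open>auto simp: orthonormal_def\<close>)
          also have "\<dots> = herm x e"
            using E(1) e True by (simp add: sum.delta)
          finally show ?thesis by simp
        next
          case False
          then show ?thesis using E(4)[OF e] x'W by (auto simp: eig_def perp_def)
        qed
        ultimately have "x' \<in> {x \<in> W. \<forall>e\<in>E. herm x e = 0}" by blast
        then have "x' = 0" using True by blast
        then have "x = (\<Sum>e\<in>E \<inter> W. herm x e *s e)"
          unfolding x'_def by (rule eq_iff_diff_eq_0[THEN iffD2])
        then have "herm x y = herm (\<Sum>e\<in>E \<inter> W. herm x e *s e) y"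
          by (rule arg_cong)
        also have "\<dots> = (\<Sum>e\<in>E \<inter> W. herm x e * herm e y)"
          by (simp only: herm_sum_left herm_smult_left)
        also have "\<dots> = 0"
          by (rule sum.neutral) (use y(2) herm_eq_0_commute in auto)
        finally show ?thesis .
      qed
      then show ?thesis using y by (auto simp: perp_def)
    qed
    then obtain y where y: "norm y = 1" "\<And>e. e \<in> E \<Longrightarrow> herm y e = 0" "eig y \<or> perp y" by blast
    show ?case
    proof (intro exI[of _ "insert y E"] conjI ballI)
      show "finite (insert y E)" "card (insert y E) = Suc k" "orthonormal (insert y E)"
        using orthonormal_insert[OF E(3) y(1,2)] E(1,2) by simp_all
      show "eig e \<or> perp e" if "e \<in> insert y E" for e
        using that E(4) y(3) by blast
    qed
  qed
  obtain E where E: "finite E" "card E = CARD('m)" "orthonormal E" "\<And>e. e \<in> E \<Longrightarrow> eig e \<or> perp e"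
    using ex[OF order_refl] by metis
  have "\<exists>\<mu>. \<forall>x\<in>W. herm (L u x) e = \<mu> * herm x e" if "e \<in> E" "u \<in> U" for e u
    using E(4)[OF that(1)]
  proof
    assume "eig e"
    then show ?thesis using eig[OF _ orthonormal_norm[OF E(3) that(1)] that(2)] by blast
  next
    assume "perp e"
    then show ?thesis using W(2)[OF that(2)] by (auto simp: perp_def)
  qed
  then show ?thesis using E(1-3) by blast
qed

text \<open>The coordinate map and its inverse are the unitary change of basis.  Synthesis of a vector from
  its coordinates preserves norms, hence is injective, hence surjective by dimension; so expanding a
  vector in the basis recovers it.\<close>

lemma orthonormal_coordinates:
  fixes E :: "(complex ^ 'm) set"
  assumes E: "finite E" "card E = CARD('m)" "orthonormal E"
  obtains b :: "'m \<Rightarrow> complex ^ 'm" where "\<And>j. b j \<in> E"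
    "\<And>x. norm (\<chi> j. herm x (b j)) = norm x"
    "\<And>y. (\<chi> j. herm (\<Sum>i\<in>UNIV. y $ i *s b i) (b j)) = y"
    "\<And>x. (\<Sum>i\<in>UNIV. herm x (b i) *s b i) = x"
proof -
  obtain b :: "'m \<Rightarrow> complex ^ 'm" where b: "bij_betw b UNIV E"
    using finite_same_card_bij[of "UNIV :: 'm set" E] E by auto
  define V where "V y = (\<Sum>i\<in>UNIV. y $ i *s b i)" for y
  have bE: "b j \<in> E" for j
    using b by (auto simp: bij_betw_def)
  have on: "herm (b i) (b j) = (if i = j then 1 else 0)" for i j
    using E(3) bE b by (auto simp: orthonormal_def bij_betw_def inj_on_def)
  have UV: "herm (V y) (b j) = y $ j" for y j
    by (simp add: V_def herm_sum_left herm_smult_left on if_distrib[of "(*) _"] cong: if_cong)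
  have "of_real ((norm (V y))\<^sup>2) = (of_real ((norm y)\<^sup>2) :: complex)" for y
  proof -
    have "herm (V y) (V y) = (\<Sum>i\<in>UNIV. y $ i * cnj (herm (V y) (b i)))"
      by (subst (1) V_def) (simp add: herm_sum_left herm_smult_left cnj_herm)
    also have "\<dots> = herm y y"
      by (simp only: UV) (simp add: herm_def)
    finally show ?thesis by (simp only: herm_self)
  qed
  then have norm: "norm (V y) = norm y" for y
    by (metis norm_ge_zero of_real_eq_iff power2_eq_iff_nonneg)
  have lin: "linear V"
    by (rule linearI) (simp_all add: V_def vec.scale_left_distrib sum.distrib scaleR_eq_smult
        vec.scale_sum_right)
  have "x = 0" if "V x = 0" for x
    using norm[of x] that by simp
  then have "inj V"
    using linear_injective_0[OF lin] by blast
  then have "surj V"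
    by (rule linear_inj_imp_surj[OF lin])
  have VU: "V (\<chi> j. herm x (b j)) = x" for x
  proof -
    obtain y where "x = V y" using \<open>surj V\<close> by blast
    then show ?thesis by (simp add: UV vec_lambda_eta)
  qed
  show ?thesis
  proof (rule that)
    show "norm (\<chi> j. herm x (b j)) = norm x" for x
      using norm VU by metis
    show "(\<chi> j. herm (\<Sum>i\<in>UNIV. y $ i *s b i) (b j)) = y" for y
      using UV[of y] by (simp add: V_def vec_eq_iff)
    show "(\<Sum>i\<in>UNIV. herm x (b i) *s b i) = x" for x
      using VU[of x] by (simp add: V_def)
  qed (rule bE)
qed

section \<open>Transitivity of the automorphism group\<close>

text \<open>The involutive automorphism that exchanges \<open>a\<close> and the origin.  With \<open>P\<close> the orthogonal
  projection to the line of \<open>a\<close>, its numerator is \<open>a - P z - s (z - P z)\<close>; the coefficient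
  \<open>1 / (1 + s)\<close> stands for \<open>(1 - s) / \<bar>a\<bar>\<^sup>2\<close>, and so covers \<open>a = 0\<close> as well.\<close>

definition moebius :: "complex ^ 'n \<Rightarrow> complex ^ 'n \<Rightarrow> complex ^ 'n"
  where "moebius a z = (let s = of_real (sqrt (1 - (norm a)\<^sup>2)) in
    inverse (1 - herm z a) *s (a - s *s z - (inverse (1 + s) * herm z a) *s a))"

lemma bounded_bilinear_smult: "bounded_bilinear ((*s) :: complex \<Rightarrow> complex ^ 'n \<Rightarrow> complex ^ 'n)"
proof
  show "\<exists>K. \<forall>(c :: complex) (x :: complex ^ 'n). norm (c *s x) \<le> norm c * norm x * K"
    by (rule exI[of _ 1]) (simp add: norm_smult_vec)
qed (simp_all add: vec_eq_iff algebra_simps)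

lemma moebius_denominator:
  assumes "norm a < 1" "norm z < 1"
  shows "1 - herm z a \<noteq> 0"
proof -
  have "norm (herm z a) < 1"
    using norm_herm_le[of z a] assms by (smt (verit) mult_left_le mult_le_one norm_ge_zero mult_left_le_one_le)
  then show ?thesis by auto
qed

lemma holomorphic_moebius:
  fixes a :: "complex ^ 'n"
  assumes a: "norm a < 1"
  shows "holomorphic_map_on (moebius a) unit_ball"
  unfolding holomorphic_map_on_def
proof
  fix z :: "complex ^ 'n" assume "z \<in> unit_ball"
  then have nz: "1 - herm z a \<noteq> 0"
    using moebius_denominator[OF a] by simp
  define s where "s = complex_of_real (sqrt (1 - (norm a)\<^sup>2))"
  define k where "k = inverse (1 + s)"
  define N where "N z = a - s *s z - (k * herm z a) *s a" for z
  define D where "D v = inverse (1 - herm z a) *s (- (s *s v) - (k * herm v a) *s a)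
      + (inverse (1 - herm z a) * herm v a * inverse (1 - herm z a)) *s N z" for v
  have bl1: "bounded_linear ((*s) s :: complex ^ 'n \<Rightarrow> complex ^ 'n)"
    by (rule bounded_bilinear.bounded_linear_right[OF bounded_bilinear_smult])
  have dh: "((\<lambda>z. herm z a) has_derivative (\<lambda>v. herm v a)) (at z within unit_ball)"
    by (rule bounded_linear_imp_has_derivative[OF bounded_linear_herm])
  have dN: "(N has_derivative (\<lambda>v. 0 - s *s v - (k * herm v a) *s a)) (at z within unit_ball)"
    unfolding N_def
    by (intro has_derivative_diff has_derivative_const bounded_linear_imp_has_derivative[OF bl1]
        bounded_linear.has_derivative[OF bounded_bilinear.bounded_linear_left[OF bounded_bilinear_smult]]
        has_derivative_mult_right dh)
  have di: "((\<lambda>z. inverse (1 - herm z a)) has_derivative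
      (\<lambda>v. - (inverse (1 - herm z a) * (0 - herm v a) * inverse (1 - herm z a)))) (at z within unit_ball)"
    by (rule Deriv.has_derivative_inverse[where f = "\<lambda>z. 1 - herm z a", OF nz])
      (intro has_derivative_diff has_derivative_const dh)
  have "((\<lambda>z. inverse (1 - herm z a) *s N z) has_derivative D) (at z within unit_ball)"
    using bounded_bilinear.FDERIV[OF bounded_bilinear_smult di dN] by (simp add: D_def[abs_def])
  moreover have "(\<lambda>z. inverse (1 - herm z a) *s N z) = moebius a"
    by (simp add: fun_eq_iff moebius_def Let_def N_def k_def s_def)
  moreover have "D (c *s v) = c *s D v" for c v
    by (simp add: D_def herm_simps vec_eq_iff algebra_simps)
  ultimately show "\<exists>D. (moebius a has_derivative D) (at z within unit_ball) \<and> (\<forall>c v. D (c *s v) = c *s D v)"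
    by auto
qed

context
  fixes a :: "complex ^ 'n"
  assumes a: "norm a < 1"
begin

private definition "s = complex_of_real (sqrt (1 - (norm a)\<^sup>2))"
private definition "k = inverse (1 + s)"

private lemma sk: "cnj s = s" "cnj k = k" "k * (1 + s) = 1" "herm a a = 1 - s\<^sup>2" "s \<noteq> 0"
proof -
  have lt: "(norm a)\<^sup>2 < 1" using a by (simp add: abs_square_less_1)
  have r: "sqrt (1 - (norm a)\<^sup>2) > 0" using lt by simp
  show "cnj s = s" "cnj k = k" "s \<noteq> 0"
    using r by (simp_all add: s_def k_def)
  have "1 + s = of_real (1 + sqrt (1 - (norm a)\<^sup>2))"
    by (simp add: s_def)
  then have "1 + s \<noteq> 0" using r by (metis add_pos_pos of_real_eq_0_iff order_less_irrefl zero_less_one)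
  then show "k * (1 + s) = 1" by (simp add: k_def)
  have "s\<^sup>2 = of_real (1 - (norm a)\<^sup>2)"
    using lt unfolding s_def of_real_power[symmetric] by simp
  then show "herm a a = 1 - s\<^sup>2"
    by (simp add: herm_self)
qed

private lemma moebius_eq:
  "moebius a z = inverse (1 - herm z a) *s (a - s *s z - (k * herm z a) *s a)"
  by (simp add: moebius_def Let_def s_def k_def)

text \<open>This rests on the identity
  \<open>1 - \<bar>moebius a z\<bar>\<^sup>2 = (1 - \<bar>a\<bar>\<^sup>2) (1 - \<bar>z\<bar>\<^sup>2) / \<bar>1 - herm z a\<bar>\<^sup>2\<close>.\<close>

lemma moebius_maps:
  assumes z: "norm z < 1"
  shows "norm (moebius a z) < 1"
proof -
  define t where "t = herm z a"
  define N where "N = a - s *s z - (k * t) *s a"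
  have w: "moebius a z = inverse (1 - t) *s N"
    by (simp add: moebius_eq t_def N_def)
  have t': "herm a z = cnj t" by (simp add: t_def cnj_herm)
  have "herm N N = (1 - t) * cnj (1 - t) - s\<^sup>2 * (1 - herm z z)"
  proof -
    have "herm N N = (1 - k * t) * (1 - k * cnj t) * (1 - s\<^sup>2) - s * (1 - k * cnj t) * t
        - s * (1 - k * t) * cnj t + s * s * herm z z"
      by (simp add: N_def herm_simps sk t' t_def[symmetric] algebra_simps)
    then show ?thesis
      using sk(3) by simp algebra
  qed
  also have "s\<^sup>2 = of_real (1 - (norm a)\<^sup>2)"
    using sk(4) by (simp add: herm_self)
  finally have "of_real ((norm N)\<^sup>2) =
      complex_of_real ((norm (1 - t))\<^sup>2 - (1 - (norm a)\<^sup>2) * (1 - (norm z)\<^sup>2))"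
    by (simp only: herm_self complex_norm_square[symmetric] of_real_diff of_real_mult of_real_1)
  then have "(norm N)\<^sup>2 = (norm (1 - t))\<^sup>2 - (1 - (norm a)\<^sup>2) * (1 - (norm z)\<^sup>2)"
    using of_real_eq_iff by blast
  moreover have "(1 - (norm a)\<^sup>2) * (1 - (norm z)\<^sup>2) > 0"
    using a z by (simp add: abs_square_less_1)
  ultimately have "(norm N)\<^sup>2 < (norm (1 - t))\<^sup>2"
    by simp
  then have "norm N < norm (1 - t)"
    by (rule power2_less_imp_less) simp
  moreover have "1 - t \<noteq> 0"
    using moebius_denominator[OF a z] by (simp add: t_def)
  ultimately show ?thesis
    unfolding w norm_smult_vec norm_inverse by (simp add: divide_inverse[symmetric] mult.commute)
qed

lemma moebius_involution:
  assumes z: "norm z < 1"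
  shows "moebius a (moebius a z) = z"
proof -
  define t where "t = herm z a"
  define N where "N = a - s *s z - (k * t) *s a"
  have D: "1 - t \<noteq> 0"
    using moebius_denominator[OF a z] by (simp add: t_def)
  have w: "moebius a z = inverse (1 - t) *s N"
    by (simp add: moebius_eq t_def N_def)
  have "herm N a = (1 - s\<^sup>2) - s * t - k * t * (1 - s\<^sup>2)"
    by (simp add: N_def herm_simps sk t_def)
  then have hN: "herm N a = 1 - s\<^sup>2 - t"
    using sk(3) by simp algebra
  have hw: "herm (moebius a z) a = (1 - s\<^sup>2 - t) / (1 - t)"
    by (simp add: w herm_simps hN divide_inverse mult.commute)
  have hw': "1 - herm (moebius a z) a = s\<^sup>2 / (1 - t)"
    using D by (simp add: hw field_simps)
  have ww: "moebius a (moebius a z) = inverse (s\<^sup>2 / (1 - t)) *s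
      (a - s *s moebius a z - (k * ((1 - s\<^sup>2 - t) / (1 - t))) *s a)"
    by (subst moebius_eq[of "moebius a z"], subst hw', subst hw, rule refl)
  have "moebius a (moebius a z) $ i = z $ i" for i
  proof -
    define d where "d = inverse (1 - t)"
    have d: "(1 - t) * d = 1"
      using D by (simp add: d_def)
    have "(1 - t) * (a $ i - s * (d * (a $ i - s * z $ i - k * t * a $ i))
        - k * ((1 - s\<^sup>2 - t) * d) * a $ i) = s\<^sup>2 * z $ i"
      using sk(3) d by algebra
    moreover have "moebius a (moebius a z) $ i = inverse (s\<^sup>2) * ((1 - t) *
        (a $ i - s * (d * (a $ i - s * z $ i - k * t * a $ i)) - k * ((1 - s\<^sup>2 - t) * d) * a $ i))"
      unfolding ww by (simp add: w N_def divide_inverse d_def algebra_simps)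
    ultimately show ?thesis
      using sk(5) by (simp add: field_simps)
  qed
  then show ?thesis
    by (simp add: vec_eq_iff)
qed

lemma moebius_self: "moebius a a = 0"
proof -
  have "(1 - s - k * (1 - s\<^sup>2)) = 0"
    using sk(3) by algebra
  then have "(1 - s - k * (1 - s\<^sup>2)) * a $ i = 0" for i
    by simp
  then have "a - s *s a - (k * herm a a) *s a = 0"
    unfolding sk(4) by (simp add: vec_eq_iff algebra_simps)
  then show ?thesis
    by (simp add: moebius_eq)
qed

lemma moebius_ball_Aut: "restrict (moebius a) unit_ball \<in> carrier ball_Aut"
  by (intro ball_AutI[of _ "moebius a"] holomorphic_moebius a moebius_maps moebius_involution)

end

section \<open>Proper maps and automorphisms\<close>

lemma holomorphic_map_on_linear:
  fixes L :: "complex ^ 'n \<Rightarrow> complex ^ 'm"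
  assumes "Vector_Spaces.linear (*s) (*s) L"
  shows "holomorphic_map_on L S"
proof -
  interpret L: Vector_Spaces.linear "(*s)" "(*s)" L by (rule assms)
  have "bounded_linear L"
    by (intro linear_conv_bounded_linear[THEN iffD1] linearI) (simp_all add: L.add L.scale scaleR_eq_smult)
  then show ?thesis
    unfolding holomorphic_map_on_def using L.scale bounded_linear_imp_has_derivative by blast
qed

lemma holomorphic_map_on_imp_continuous_on: "holomorphic_map_on f S \<Longrightarrow> continuous_on S f"
  unfolding holomorphic_map_on_def continuous_on_eq_continuous_within
  using has_derivative_continuous by blast

lemma proper_ball_map_maps:
  assumes "proper_holomorphic_ball_map f" "norm z < 1"
  shows "norm (f z) < 1"
proof -
  have "f ` unit_ball \<subseteq> unit_ball"
    using assms(1) unfolding proper_holomorphic_ball_map_iff_compact_preimage by (elim conjE)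
  then show ?thesis
    using assms(2) by (simp add: image_subset_iff)
qed

lemma proper_ball_map_cong:
  assumes "proper_holomorphic_ball_map f" and eq: "\<And>z. norm z < 1 \<Longrightarrow> f z = g z"
  shows "proper_holomorphic_ball_map g"
proof -
  have "{z \<in> unit_ball. f z \<in> K} = {z \<in> unit_ball. g z \<in> K}" for K
    using eq by auto
  moreover have "f ` unit_ball = g ` unit_ball"
    using eq by (intro image_cong) auto
  moreover have "holomorphic_map_on f unit_ball \<Longrightarrow> holomorphic_map_on g unit_ball"
    by (erule holomorphic_map_on_cong) (use eq in auto)
  ultimately show ?thesis
    using assms(1) unfolding proper_holomorphic_ball_map_iff_compact_preimage by simp
qed

text \<open>The preimage of a compact set under the composition is an image, under an inverse
  automorphism, of a preimage under \<open>f\<close>.\<close>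

lemma proper_ball_map_Aut:
  assumes f: "proper_holomorphic_ball_map f" and \<gamma>: "\<gamma> \<in> carrier ball_Aut" and \<psi>: "\<psi> \<in> carrier ball_Aut"
  shows "proper_holomorphic_ball_map (\<lambda>z. \<psi> (f (\<gamma> z)))"
  unfolding proper_holomorphic_ball_map_iff_compact_preimage
proof (intro conjI allI impI)
  have hf: "holomorphic_map_on f unit_ball"
    using f by (simp add: proper_holomorphic_ball_map_def)
  have "holomorphic_map_on (\<lambda>z. f (\<gamma> z)) unit_ball"
    by (rule holomorphic_map_on_compose[OF ball_Aut_holomorphic[OF \<gamma>] hf])
      (use ball_Aut_maps[OF \<gamma>] in auto)
  then show "holomorphic_map_on (\<lambda>z. \<psi> (f (\<gamma> z))) unit_ball"
    by (rule holomorphic_map_on_compose[OF _ ball_Aut_holomorphic[OF \<psi>]])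
      (use ball_Aut_maps[OF \<gamma>] proper_ball_map_maps[OF f] in auto)
  show "(\<lambda>z. \<psi> (f (\<gamma> z))) ` unit_ball \<subseteq> unit_ball"
    using ball_Aut_maps[OF \<gamma>] proper_ball_map_maps[OF f] ball_Aut_maps[OF \<psi>] by auto
  fix K :: "(complex ^ 'b) set" assume K: "K \<subseteq> unit_ball" "compact K"
  let ?i = "\<lambda>x. inv\<^bsub>ball_Aut\<^esub> x"
  have cont: "continuous_on S \<delta>" if "\<delta> \<in> carrier ball_Aut" "S \<subseteq> unit_ball" for \<delta> :: "complex ^ 'x \<Rightarrow> _" and S
    using that continuous_on_subset holomorphic_map_on_imp_continuous_on ball_Aut_holomorphic by blast
  have "compact (?i \<psi> ` K)"
    using K ball_Aut_inv_closed[OF \<psi>] by (intro compact_continuous_image cont)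
  moreover have "?i \<psi> ` K \<subseteq> unit_ball"
    using K ball_Aut_maps[OF ball_Aut_inv_closed[OF \<psi>]] by auto
  ultimately have "compact {w \<in> unit_ball. f w \<in> ?i \<psi> ` K}"
    using f unfolding proper_holomorphic_ball_map_iff_compact_preimage by blast
  then have "compact (?i \<gamma> ` {w \<in> unit_ball. f w \<in> ?i \<psi> ` K})"
    using ball_Aut_inv_closed[OF \<gamma>] by (intro compact_continuous_image cont) auto
  moreover have "{z \<in> unit_ball. \<psi> (f (\<gamma> z)) \<in> K} = ?i \<gamma> ` {w \<in> unit_ball. f w \<in> ?i \<psi> ` K}"
  proof (intro equalityI subsetI)
    fix z assume z: "z \<in> {z \<in> unit_ball. \<psi> (f (\<gamma> z)) \<in> K}"
    then have "norm (f (\<gamma> z)) < 1" "norm (\<gamma> z) < 1"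
      using ball_Aut_maps[OF \<gamma>] proper_ball_map_maps[OF f] by auto
    then have "f (\<gamma> z) \<in> ?i \<psi> ` K"
      using z ball_Aut_inv_left[OF \<psi>] by (metis (mono_tags, lifting) image_eqI mem_Collect_eq)
    then show "z \<in> ?i \<gamma> ` {w \<in> unit_ball. f w \<in> ?i \<psi> ` K}"
      using z \<open>norm (\<gamma> z) < 1\<close> ball_Aut_inv_left[OF \<gamma>] by (intro image_eqI[of _ _ "\<gamma> z"]) auto
  next
    fix z assume "z \<in> ?i \<gamma> ` {w \<in> unit_ball. f w \<in> ?i \<psi> ` K}"
    then obtain w x where w: "norm w < 1" "z = ?i \<gamma> w" "f w = ?i \<psi> x" "x \<in> K" by auto
    then have "norm x < 1" using K by auto
    then show "z \<in> {z \<in> unit_ball. \<psi> (f (\<gamma> z)) \<in> K}"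
      using w ball_Aut_inv_right[OF \<gamma> w(1)] ball_Aut_inv_right[OF \<psi>] ball_Aut_maps[OF ball_Aut_inv_closed[OF \<gamma>]]
      by auto
  qed
  ultimately show "compact {z \<in> unit_ball. \<psi> (f (\<gamma> z)) \<in> K}"
    by simp
qed

section \<open>Tori of symmetries and monomial maps\<close>

lemma monom_fun_diagonal:
  "monom_fun \<alpha> (\<chi> i. u i * z $ i) = (\<Prod>i\<in>UNIV. u i ^ \<alpha> i) * monom_fun \<alpha> z"
  by (simp add: monom_fun_def power_mult_distrib prod.distrib)

text \<open>A diagonal unitary \<open>u\<close> multiplies the \<open>j\<close>-th component of \<open>g\<close> by the unit scalar \<open>u ^ \<alpha> j\<close>.
  Hence it acts on \<open>g\<close> as a diagonal unitary of the target, and \<open>\<phi>\<close> and \<open>\<psi>\<close> transport this to \<open>f\<close>.\<close>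

lemma monomial_imp_contains_full_torus:
  assumes g: "proper_holomorphic_ball_map g" "monomial_ball_map g" and eq: "spherically_equivalent f g"
  shows "contains_full_torus (Hermitian_invariant_group f)"
proof -
  obtain \<phi> \<psi> where \<phi>: "\<phi> \<in> carrier ball_Aut" and \<psi>: "\<psi> \<in> carrier ball_Aut"
    and f: "\<And>z. norm z < 1 \<Longrightarrow> f z = \<psi> (g (\<phi> z))"
    using eq by (auto simp: spherically_equivalent_def)
  obtain c \<alpha> where mono: "\<And>j z. norm z < 1 \<Longrightarrow> g z $ j = c j * monom_fun (\<alpha> j) z"
    using g(2) unfolding monomial_ball_map_def by (metis mem_ball_0)
  let ?\<phi>' = "inv\<^bsub>ball_Aut\<^esub> \<phi>"
  note \<phi>' = ball_Aut_inv_closed[OF \<phi>]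
  have "?\<phi>' \<otimes>\<^bsub>ball_Aut\<^esub> t \<otimes>\<^bsub>ball_Aut\<^esub> inv\<^bsub>ball_Aut\<^esub> ?\<phi>' \<in> Hermitian_invariant_group f"
    if t: "t \<in> diagonal_torus" for t
  proof -
    obtain u where u: "t = (\<lambda>z\<in>unit_ball. \<chi> i. u i * z $ i)" "\<And>i. norm (u i) = 1"
      using t unfolding diagonal_torus_def by blast
    have tA: "t \<in> carrier ball_Aut"
      using t diagonal_torus_subset_ball_Aut by blast
    define V where "V = (\<lambda>z\<in>unit_ball. \<chi> j. (\<Prod>i\<in>UNIV. u i ^ \<alpha> j i) * z $ j)"
    have "V \<in> diagonal_torus"
      unfolding diagonal_torus_def V_def
      by (auto intro!: exI[of _ "\<lambda>j. \<Prod>i\<in>UNIV. u i ^ \<alpha> j i"] simp: prod_norm[symmetric] norm_power u(2))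
    then have V: "V \<in> carrier ball_Aut"
      using diagonal_torus_subset_ball_Aut by blast
    have gt: "g (t w) = V (g w)" if w: "norm w < 1" for w
      using w ball_Aut_maps[OF tA w] proper_ball_map_maps[OF g(1) w]
      by (simp add: vec_eq_iff mono V_def) (simp add: u(1) monom_fun_diagonal)
    let ?\<gamma> = "?\<phi>' \<otimes>\<^bsub>ball_Aut\<^esub> t \<otimes>\<^bsub>ball_Aut\<^esub> \<phi>"
    let ?\<Psi> = "\<psi> \<otimes>\<^bsub>ball_Aut\<^esub> V \<otimes>\<^bsub>ball_Aut\<^esub> inv\<^bsub>ball_Aut\<^esub> \<psi>"
    have "f (?\<gamma> z) = ?\<Psi> (f z)" if z: "norm z < 1" for z
    proof -
      define w where "w = \<phi> z"
      have w: "norm w < 1" "norm (t w) < 1" "norm (g w) < 1"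
        using ball_Aut_maps[OF \<phi> z] ball_Aut_maps[OF tA] proper_ball_map_maps[OF g(1)] by (auto simp: w_def)
      have "?\<gamma> z = ?\<phi>' (t w)"
        using \<phi> \<phi>' tA z w by (simp add: ball_Aut_mult ball_Aut_mult_closed w_def)
      then have "f (?\<gamma> z) = \<psi> (V (g w))"
        using f[of "?\<phi>' (t w)"] ball_Aut_maps[OF \<phi>' w(2)] ball_Aut_inv_right[OF \<phi> w(2)] gt[OF w(1)] by simp
      also have "\<dots> = ?\<Psi> (\<psi> (g w))"
        using \<psi> V ball_Aut_inv_closed[OF \<psi>] w(3) ball_Aut_maps[OF \<psi> w(3)]
        by (simp add: ball_Aut_mult ball_Aut_mult_closed ball_Aut_inv_left)
      finally show ?thesis
        using f[OF z] by (simp add: w_def)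
    qed
    moreover have "inv\<^bsub>ball_Aut\<^esub> ?\<phi>' = \<phi>"
      by (rule group.inv_inv[OF group_ball_Aut \<phi>])
    ultimately show ?thesis
      using \<phi> \<phi>' tA \<psi> V ball_Aut_inv_closed[OF \<psi>]
      unfolding Hermitian_invariant_group_def by (auto intro!: ball_Aut_mult_closed bexI[of _ ?\<Psi>])
  qed
  then show ?thesis
    using \<phi>' unfolding contains_full_torus_def by blast
qed

text \<open>The automorphisms \<open>\<Phi>\<close> fix the origin, so they are linear isometries; on the span of the
  image of \<open>F\<close> they commute because diagonal matrices do.  In an orthonormal basis adapted to them
  every component of \<open>F\<close> is semi-invariant.\<close>

lemma torus_symmetric_imp_monomial:
  fixes F :: "complex ^ 'n \<Rightarrow> complex ^ 'm"
  assumes F: "proper_holomorphic_ball_map F" and F0: "F 0 = 0"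
    and sym: "\<And>u. (\<forall>i. norm (u i) = 1) \<Longrightarrow>
      \<exists>\<Phi>\<in>carrier ball_Aut. \<forall>z. norm z < 1 \<longrightarrow> F (\<chi> i. u i * z $ i) = \<Phi> (F z)"
  shows "\<exists>A B. A \<in> carrier ball_Aut \<and> B \<in> carrier ball_Aut \<and> (\<forall>z. norm z < 1 \<longrightarrow> B (A z) = z) \<and>
    monomial_ball_map (\<lambda>z. A (F z))"
proof -
  define T where "T = {u :: 'n \<Rightarrow> complex. \<forall>i. norm (u i) = 1}"
  have holF: "holomorphic_map_on F unit_ball"
    using F by (simp add: proper_holomorphic_ball_map_def)
  define P where "P u L \<longleftrightarrow> Vector_Spaces.linear (*s) (*s) L \<and> (\<forall>x. norm (L x) = norm x) \<and>
      (\<forall>z. norm z < 1 \<longrightarrow> F (\<chi> i. u i * z $ i) = L (F z))" for u L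
  have "\<exists>L. P u L" if u: "u \<in> T" for u
  proof -
    obtain \<Phi> where \<Phi>: "\<Phi> \<in> carrier ball_Aut" "\<And>z. norm z < 1 \<Longrightarrow> F (\<chi> i. u i * z $ i) = \<Phi> (F z)"
      using sym[of u] u unfolding T_def by blast
    have "(\<chi> i. u i * 0 $ i) = 0" by (simp add: vec_eq_iff)
    then have "\<Phi> 0 = 0" using \<Phi>(2)[of 0] F0 by simp
    then obtain L where "Vector_Spaces.linear (*s) (*s) L" "\<And>x. norm (L x) = norm x"
        "\<And>z. norm z < 1 \<Longrightarrow> \<Phi> z = L z"
      using ball_Aut_fix_0_linear[OF \<Phi>(1)] by blast
    then have "P u L"
      using \<Phi>(2) proper_ball_map_maps[OF F] by (simp add: P_def)
    then show ?thesis by (intro exI[of "P u" L])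
  qed
  then obtain L where PL: "\<And>u. u \<in> T \<Longrightarrow> P u (L u)"
    by metis
  have lin: "\<And>u. u \<in> T \<Longrightarrow> Vector_Spaces.linear (*s) (*s) (L u)"
    and norm: "\<And>u x. u \<in> T \<Longrightarrow> norm (L u x) = norm x"
    and L: "\<And>u z. u \<in> T \<Longrightarrow> norm z < 1 \<Longrightarrow> F (\<chi> i. u i * z $ i) = L u (F z)"
    using PL by (simp_all add: P_def)
  define W where "W = vec.span (F ` unit_ball)"
  have rot: "norm (\<chi> i. u i * z $ i) < 1" if "u \<in> T" "norm z < 1" for u and z :: "complex ^ 'n"
    using that by (simp add: T_def norm_vec_def norm_mult)
  have LW: "L u x \<in> W" if u: "u \<in> T" and x: "x \<in> W" for u x
  proof -
    interpret L: Vector_Spaces.linear "(*s)" "(*s)" "L u" by (rule lin[OF u])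
    have "vec.subspace {x. L u x \<in> W}"
      unfolding vec.subspace_def W_def
      by (auto simp: L.zero L.add L.scale vec.span_zero vec.span_add vec.span_scale)
    moreover have "F ` unit_ball \<subseteq> {x. L u x \<in> W}"
    proof clarsimp
      fix z :: "complex ^ 'n" assume z: "norm z < 1"
      then have "F (\<chi> i. u i * z $ i) \<in> F ` unit_ball"
        using rot[OF u z] by simp
      then show "L u (F z) \<in> W"
        unfolding W_def L[OF u z] by (rule vec.span_base)
    qed
    ultimately show ?thesis
      using vec.span_minimal x unfolding W_def by blast
  qed
  have comm: "L u (L v x) = L v (L u x)" if u: "u \<in> T" and v: "v \<in> T" and x: "x \<in> W" for u v x
  proof -
    interpret Lu: Vector_Spaces.linear "(*s)" "(*s)" "L u" by (rule lin[OF u])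
    interpret Lv: Vector_Spaces.linear "(*s)" "(*s)" "L v" by (rule lin[OF v])
    have "vec.subspace {x. L u (L v x) = L v (L u x)}"
      unfolding vec.subspace_def by (simp add: Lu.zero Lv.zero Lu.add Lv.add Lu.scale Lv.scale)
    moreover have "F ` unit_ball \<subseteq> {x. L u (L v x) = L v (L u x)}"
    proof clarsimp
      fix z :: "complex ^ 'n" assume z: "norm z < 1"
      have "(\<chi> i. u i * (\<chi> i. v i * z $ i) $ i) = (\<chi> i. v i * (\<chi> i. u i * z $ i) $ i)"
        by (simp add: vec_eq_iff)
      then show "L u (L v (F z)) = L v (L u (F z))"
        using L[OF u z] L[OF v z] L[OF u rot[OF v z]] L[OF v rot[OF u z]] by simp
    qed
    ultimately show ?thesis
      using vec.span_minimal x unfolding W_def by blast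
  qed
  have "vec.subspace W" by (simp add: W_def)
  then obtain E where E: "finite E" "card E = CARD('m)" "orthonormal E"
    and semi: "\<And>e u. e \<in> E \<Longrightarrow> u \<in> T \<Longrightarrow> \<exists>\<mu>. \<forall>x\<in>W. herm (L u x) e = \<mu> * herm x e"
    using adapted_orthonormal_basis[of T L W, OF lin norm _ LW comm] by blast
  obtain b :: "'m \<Rightarrow> complex ^ 'm" where b: "\<And>j. b j \<in> E"
    and nU: "\<And>x. norm (\<chi> j. herm x (b j)) = norm x"
    and UV: "\<And>y. (\<chi> j. herm (\<Sum>i\<in>UNIV. y $ i *s b i) (b j)) = y"
    and VU: "\<And>x. (\<Sum>i\<in>UNIV. herm x (b i) *s b i) = x"
    using orthonormal_coordinates[OF E] by blast
  define U where "U x = (\<chi> j. herm x (b j))" for x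
  define V where "V y = (\<Sum>i\<in>UNIV. y $ i *s b i)" for y
  have UV': "U (V y) = y" and VU': "V (U x) = x" for x y
    using UV VU by (simp_all add: U_def V_def)
  have nU': "norm (U x) = norm x" and nV: "norm (V y) = norm y" for x y
    using nU UV' by (simp add: U_def, metis nU U_def UV')
  have holU: "holomorphic_map_on U unit_ball"
    by (intro holomorphic_map_on_linear Vector_Spaces.linear.intro vec.vector_space_axioms)
      (unfold_locales, auto simp: U_def vec_eq_iff herm_simps)
  have holV: "holomorphic_map_on V unit_ball"
    by (intro holomorphic_map_on_linear Vector_Spaces.linear.intro vec.vector_space_axioms)
      (unfold_locales, auto simp: V_def vec.scale_left_distrib sum.distrib vec.scale_sum_right)
  have A: "restrict U unit_ball \<in> carrier ball_Aut" "restrict V unit_ball \<in> carrier ball_Aut"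
    by (auto intro!: ball_AutI[OF holU holV] ball_AutI[OF holV holU] simp: nU' nV UV' VU')
  have "\<exists>c \<alpha>. \<forall>z. norm z < 1 \<longrightarrow> herm (F z) (b j) = c * monom_fun \<alpha> z" for j
  proof (rule semi_invariant_is_monomial[OF holF])
    fix u :: "'n \<Rightarrow> complex" assume "\<forall>i. norm (u i) = 1"
    then have u: "u \<in> T" by (simp add: T_def)
    obtain \<mu> where "\<And>x. x \<in> W \<Longrightarrow> herm (L u x) (b j) = \<mu> * herm x (b j)"
      using semi[OF b u] by blast
    then show "\<exists>\<mu>. \<forall>z. norm z < 1 \<longrightarrow> herm (F (\<chi> i. u i * z $ i)) (b j) = \<mu> * herm (F z) (b j)"
      using L[OF u] by (intro exI[of _ \<mu>]) (simp add: W_def vec.span_base)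
  qed
  then have "monomial_ball_map (\<lambda>z. restrict U unit_ball (F z))"
    using proper_ball_map_maps[OF F] by (simp add: monomial_ball_map_def U_def Ball_def)
  then show ?thesis
    using A nU' VU' by (intro exI[of _ "restrict U unit_ball"] exI[of _ "restrict V unit_ball"]) auto
qed

text \<open>The diagonal torus fixes the origin, so every target automorphism that intertwines it fixes the image
  under \<open>f\<close> of the fixed point of the conjugated torus.  Moving that image to the origin gives a map with linear torus symmetries.\<close>

lemma contains_full_torus_imp_monomial:
  fixes f :: "complex ^ 'n \<Rightarrow> complex ^ 'm"
  assumes f: "proper_holomorphic_ball_map f" and torus: "contains_full_torus (Hermitian_invariant_group f)"
  shows "\<exists>g :: complex ^ 'n \<Rightarrow> complex ^ 'm.
    proper_holomorphic_ball_map g \<and> monomial_ball_map g \<and> spherically_equivalent f g"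
proof -
  obtain \<phi> where \<phi>: "\<phi> \<in> carrier ball_Aut"
    and inv: "\<And>t. t \<in> diagonal_torus \<Longrightarrow>
      \<phi> \<otimes>\<^bsub>ball_Aut\<^esub> t \<otimes>\<^bsub>ball_Aut\<^esub> inv\<^bsub>ball_Aut\<^esub> \<phi> \<in> Hermitian_invariant_group f"
    using torus unfolding contains_full_torus_def by blast
  note \<phi>' = ball_Aut_inv_closed[OF \<phi>]
  have h: "\<exists>\<psi>\<in>carrier ball_Aut. \<forall>z. norm z < 1 \<longrightarrow> f (\<phi> (\<chi> i. u i * z $ i)) = \<psi> (f (\<phi> z))"
    if u: "\<forall>i. norm (u i) = 1" for u
  proof -
    define t where "t = (\<lambda>z\<in>unit_ball. \<chi> i. u i * z $ i)"
    have t: "t \<in> diagonal_torus" using u by (auto simp: diagonal_torus_def t_def)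
    have tA: "t \<in> carrier ball_Aut" using t diagonal_torus_subset_ball_Aut by blast
    obtain \<psi> where \<psi>: "\<psi> \<in> carrier ball_Aut"
      "\<And>z. norm z < 1 \<Longrightarrow> f ((\<phi> \<otimes>\<^bsub>ball_Aut\<^esub> t \<otimes>\<^bsub>ball_Aut\<^esub> inv\<^bsub>ball_Aut\<^esub> \<phi>) z) = \<psi> (f z)"
      using inv[OF t] unfolding Hermitian_invariant_group_def by auto
    have "f (\<phi> (\<chi> i. u i * z $ i)) = \<psi> (f (\<phi> z))" if z: "norm z < 1" for z
      using \<psi>(2)[OF ball_Aut_maps[OF \<phi> z]] \<phi> \<phi>' tA z ball_Aut_maps[OF \<phi> z]
      by (simp add: ball_Aut_mult ball_Aut_mult_closed ball_Aut_inv_left) (simp add: t_def)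
    then show ?thesis using \<psi>(1) by blast
  qed
  define a where "a = f (\<phi> 0)"
  have a: "norm a < 1"
    unfolding a_def by (intro proper_ball_map_maps[OF f] ball_Aut_maps[OF \<phi>]) simp
  define \<theta> where "\<theta> = restrict (moebius a) unit_ball"
  have \<theta>: "\<theta> \<in> carrier ball_Aut" "\<theta> a = 0"
    using moebius_ball_Aut[OF a] moebius_self[OF a] a by (auto simp: \<theta>_def)
  note \<theta>' = ball_Aut_inv_closed[OF \<theta>(1)]
  define F where "F z = \<theta> (f (\<phi> z))" for z
  have F: "proper_holomorphic_ball_map F"
    unfolding F_def by (rule proper_ball_map_Aut[OF f \<phi> \<theta>(1)])
  have F0: "F 0 = 0" using \<theta>(2) by (simp add: F_def a_def)
  have fb: "norm (f (\<phi> z)) < 1" if "norm z < 1" for z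
    using that proper_ball_map_maps[OF f] ball_Aut_maps[OF \<phi>] by blast
  have "\<exists>\<Phi>\<in>carrier ball_Aut. \<forall>z. norm z < 1 \<longrightarrow> F (\<chi> i. u i * z $ i) = \<Phi> (F z)"
    if u: "\<forall>i. norm (u i) = 1" for u
  proof -
    obtain \<psi> where \<psi>: "\<psi> \<in> carrier ball_Aut"
      "\<And>z. norm z < 1 \<Longrightarrow> f (\<phi> (\<chi> i. u i * z $ i)) = \<psi> (f (\<phi> z))"
      using h[OF u] by blast
    let ?\<Phi> = "\<theta> \<otimes>\<^bsub>ball_Aut\<^esub> \<psi> \<otimes>\<^bsub>ball_Aut\<^esub> inv\<^bsub>ball_Aut\<^esub> \<theta>"
    have "F (\<chi> i. u i * z $ i) = ?\<Phi> (F z)" if z: "norm z < 1" for z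
      using \<theta>(1) \<theta>' \<psi>(1) fb[OF z] ball_Aut_maps[OF \<theta>(1) fb[OF z]]
      by (simp add: F_def \<psi>(2)[OF z] ball_Aut_mult ball_Aut_mult_closed ball_Aut_inv_left)
    moreover have "?\<Phi> \<in> carrier ball_Aut"
      using \<theta>(1) \<theta>' \<psi>(1) by (intro ball_Aut_mult_closed)
    ultimately show ?thesis by blast
  qed
  then have "\<exists>A B. A \<in> carrier ball_Aut \<and> B \<in> carrier ball_Aut \<and> (\<forall>z. norm z < 1 \<longrightarrow> B (A z) = z) \<and>
      monomial_ball_map (\<lambda>z. A (F z))"
    by (rule torus_symmetric_imp_monomial[OF F F0])
  then obtain A B where A: "A \<in> carrier ball_Aut" and B: "B \<in> carrier ball_Aut"
    and BA: "\<And>z. norm z < 1 \<Longrightarrow> B (A z) = z" and mono: "monomial_ball_map (\<lambda>z. A (F z))"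
    by blast
  define g where "g z = A (F z)" for z
  have "proper_holomorphic_ball_map g"
    by (rule proper_ball_map_cong[OF proper_ball_map_Aut[OF f \<phi> ball_Aut_mult_closed[OF A \<theta>(1)]]])
      (simp add: g_def F_def ball_Aut_mult A \<theta>(1) fb)
  moreover have "spherically_equivalent f g"
    unfolding spherically_equivalent_def
  proof (intro bexI[of _ "inv\<^bsub>ball_Aut\<^esub> \<phi>"] bexI[of _ "inv\<^bsub>ball_Aut\<^esub> \<theta> \<otimes>\<^bsub>ball_Aut\<^esub> B"] ballI)
    fix z :: "complex ^ 'n" assume "z \<in> unit_ball"
    then have z: "norm z < 1" by simp
    have Fz: "F ((inv\<^bsub>ball_Aut\<^esub> \<phi>) z) = \<theta> (f z)"
      using ball_Aut_inv_right[OF \<phi> z] by (simp add: F_def)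
    have "norm (\<theta> (f z)) < 1" "norm (f z) < 1"
      using ball_Aut_maps[OF \<theta>(1)] proper_ball_map_maps[OF f z] by auto
    then show "f z = (inv\<^bsub>ball_Aut\<^esub> \<theta> \<otimes>\<^bsub>ball_Aut\<^esub> B) (g ((inv\<^bsub>ball_Aut\<^esub> \<phi>) z))"
      using \<theta>' B BA ball_Aut_maps[OF A] ball_Aut_inv_left[OF \<theta>(1)] by (simp add: g_def Fz ball_Aut_mult)
  qed (use \<phi>' \<theta>' B in \<open>auto intro: ball_Aut_mult_closed\<close>)
  ultimately show ?thesis
    using mono unfolding g_def by blast
qed

theorem theorem5p1:
  fixes f :: "complex ^ 'n \<Rightarrow> complex ^ 'm"
  assumes "CARD('n) \<le> CARD('m)"
    and "proper_holomorphic_ball_map f"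
    and "rational_ball_map f"
  shows "contains_full_torus (Hermitian_invariant_group f) \<longleftrightarrow>
    (\<exists>g :: complex ^ 'n \<Rightarrow> complex ^ 'm.
       proper_holomorphic_ball_map g \<and> monomial_ball_map g \<and> spherically_equivalent f g)"
  using contains_full_torus_imp_monomial[OF assms(2)] monomial_imp_contains_full_torus by blast

end
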